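(* Fix an integer $l \geq 1$. There exist a real constant $\alpha$ (depending only on $l$) and a deterministic algorithm with the following property. Let $k \geq 1$, let $G$ be a monotone exact linear, $l$-regular, $k$-uniform CNF formula with $n = |V(G)|$ variables, let $p \in \{2, \ldots, l n\}$, and let $F$ be a monotone entangled linear $p$-chain with generator $G$. Then, given $F$, the algorithm decides whether $F$ is x-sat in time $O\left(\exp\left(\alpha \ln(n)\sqrt{n}\right)\right)$ at most, with implied constant depending only on $l$.
   Context: A monotone CNF formula $F$ is a finite non-empty set (conjunction) of clauses in which every clause is a finite non-empty set (disjunction) of positive literals, i.e. of (unnegated) Boolean variables. $V(C)$ is the set of variables occurring in the clause $C$, and $V(F)$ the set of variables occurring in $F$. $F$ is exact linear if any two distinct clauses $C, C' \in F$ satisfy $|V(C) \cap V(C')| = 1$. $F$ is $l$-regular if every variable $x \in V(F)$ occurs in exactly $l$ clauses of $F$, and $k$-uniform if every clause of $F$ contains exactly $k$ literals. $F$ is x-sat if there is a truth assignment $V(F) \to \{0,1\}$ under which exactly one literal in each clause of $F$ is true. Linear chains. Let $G$ (the generator) be a monotone exact linear, $l$-regular, $k$-uniform CNF formula with clauses $C_1,\ldots,C_m$ and variables $a_1,\ldots,a_n$. A linear $p$-chain with generator $G$ is the union $G^{(1)} \cup \cdots \cup G^{(p)}$ of $p$ copies (links) of $G$ on pairwise disjoint variable sets: $G^{(\lambda)}$ has variables $a^{(\lambda)}_1,\ldots,a^{(\lambda)}_n$ and clauses $C^{(\lambda)}_1,\ldots,C^{(\lambda)}_m$, where $a^{(\lambda)}_s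 \in C^{(\lambda)}_j$ iff $a_s \in C_j$. Entanglement. Two links $G^{(\lambda)}$ and $G^{(\lambda+1)}$ are entangled at a position $(j,s)$ with $a_s \in C_j$ by replacing the literal $a^{(\lambda)}_s$ in clause $C^{(\lambda)}_j$ by $a^{(\lambda+1)}_s$, and replacing the literal $a^{(\lambda+1)}_s$ in clause $C^{(\lambda+1)}_j$ by $a^{(\lambda)}_s$. An entangled linear $p$-chain with generator $G$ is a formula obtained from the linear $p$-chain by choosing pairwise distinct positions $(j_1,s_1),\ldots,(j_{p-1},s_{p-1})$ with $a_{s_\lambda} \in C_{j_\lambda}$, and entangling the links $G^{(\lambda)}$ and $G^{(\lambda+1)}$ at position $(j_\lambda,s_\lambda)$ for each $\lambda = 1,\ldots,p-1$. *)

theory Defs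
  imports Complex_Main
begin

section \<open>Monotone CNF formulas\<close>

text \<open>
  All literals are unnegated, so a clause is the set of its variables and a formula is a set of
  such sets: \<open>V(C)\<close> is \<open>C\<close> itself, and \<open>V(F)\<close> is the union of the clauses.
\<close>

type_synonym 'v clause = "'v set"
type_synonym 'v formula = "'v clause set"

definition monotone_cnf :: "'v formula \<Rightarrow> bool" where
  "monotone_cnf F \<longleftrightarrow> finite F \<and> F \<noteq> {} \<and> (\<forall>C\<in>F. finite C \<and> C \<noteq> {})"

definition vars :: "'v formula \<Rightarrow> 'v set" where
  "vars F = \<Union>F"

definition exact_linear :: "'v formula \<Rightarrow> bool" where
  "exact_linear F \<longleftrightarrow> (\<forall>C\<in>F. \<forall>D\<in>F. C \<noteq> D \<longrightarrow> card (C \<inter> D) = 1)"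

definition regular :: "nat \<Rightarrow> 'v formula \<Rightarrow> bool" where
  "regular l F \<longleftrightarrow> (\<forall>x\<in>vars F. card {C \<in> F. x \<in> C} = l)"

definition uniform :: "nat \<Rightarrow> 'v formula \<Rightarrow> bool" where
  "uniform k F \<longleftrightarrow> (\<forall>C\<in>F. card C = k)"

definition xsat :: "'v formula \<Rightarrow> bool" where
  "xsat F \<longleftrightarrow> (\<exists>\<tau> :: 'v \<Rightarrow> bool. \<forall>C\<in>F. \<exists>!x. x \<in> C \<and> \<tau> x)"


section \<open>Entangled linear chains\<close>

text \<open>
  The clauses of a generator are pairwise distinct, so a clause serves as its own index:
  a position \<open>(j, s)\<close> is a pair \<open>(C, s)\<close> with \<open>s \<in> C \<in> G\<close>. The pair \<open>(r, s)\<close> is the copy of the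
  variable \<open>s\<close> in link \<open>r\<close>, and a chain is kept as a family of clauses: at \<open>(r, C)\<close> it has the
  clause of link \<open>r\<close> that originates from \<open>C\<close>. Links are numbered from 1.
\<close>

type_synonym 'a chain = "nat \<times> 'a clause \<Rightarrow> (nat \<times> 'a) clause"

definition linear_chain :: "'a chain" where
  "linear_chain = (\<lambda>(r, C). Pair r ` C)"

definition entangle :: "nat \<Rightarrow> 'a clause \<times> 'a \<Rightarrow> 'a chain \<Rightarrow> 'a chain" where
  "entangle r = (\<lambda>(C, s) \<Phi>. \<Phi>
     ((r, C) := insert (r + 1, s) (\<Phi> (r, C) - {(r, s)}),
      (r + 1, C) := insert (r, s) (\<Phi> (r + 1, C) - {(r + 1, s)})))"

text \<open>
  \<open>entangle_first q pos\<close> is the linear chain after the pairs of links \<open>(1, 2), \<dots>, (q, q + 1)\<close> have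
  been entangled, links \<open>r\<close> and \<open>r + 1\<close> at \<open>pos r\<close>.
\<close>

primrec entangle_first :: "nat \<Rightarrow> (nat \<Rightarrow> 'a clause \<times> 'a) \<Rightarrow> 'a chain" where
  "entangle_first 0 pos = linear_chain"
| "entangle_first (Suc q) pos = entangle (Suc q) (pos (Suc q)) (entangle_first q pos)"

text \<open>
  The map \<open>\<rho>\<close> turns the tagged variables \<open>(r, s)\<close> into the actual variables of \<open>F\<close>; the names of
  the disjoint copies are arbitrary.
\<close>

definition entangled_chain :: "nat \<Rightarrow> 'a formula \<Rightarrow> 'v formula \<Rightarrow> bool" where
  "entangled_chain p G F \<longleftrightarrow>
     (\<exists>pos \<rho>.
        (\<forall>r\<in>{1..p-1}. fst (pos r) \<in> G \<and> snd (pos r) \<in> fst (pos r)) \<and>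
        inj_on pos {1..p-1} \<and>
        inj_on \<rho> ({1..p} \<times> vars G) \<and>
        F = (\<lambda>i. \<rho> ` entangle_first (p - 1) pos i) ` ({1..p} \<times> G))"


section \<open>A deterministic machine model with unit-cost steps\<close>

text \<open>
  Programs are finite systems of mutually recursive first-order functions, called by value, over
  binary trees with a single atom. This is the functional variant F of the WHILE language of
  N. D. Jones (Computability and Complexity from a Programming Perspective, MIT Press 1997).
  Every evaluation step reads or creates at most one cell, and the only test is whether a tree is
  the atom, so the number of steps is polynomially related to the running time of a Turing machine.

  The function with index \<open>f\<close> has the body \<open>P ! f\<close>; within it \<open>EVar i\<close> is the argument number \<open>i\<close>.
\<close>

datatype tree = Atom | Cell tree tree

datatype expr =
    EVar nat
  | EAtom
  | ECons expr expr
  | EHd expr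
  | ETl expr
  | EIf expr expr expr
  | ECall nat "expr list"

type_synonym program = "expr list"

fun head :: "tree \<Rightarrow> tree" where
  "head Atom = Atom"
| "head (Cell a b) = a"

fun tail :: "tree \<Rightarrow> tree" where
  "tail Atom = Atom"
| "tail (Cell a b) = b"

text \<open>
  \<open>eval P \<eta> e v t\<close>: with the arguments \<open>\<eta>\<close>, evaluating \<open>e\<close> terminates with the value \<open>v\<close> after
  exactly \<open>t\<close> steps.
\<close>

inductive eval :: "program \<Rightarrow> tree list \<Rightarrow> expr \<Rightarrow> tree \<Rightarrow> nat \<Rightarrow> bool"
  and evals :: "program \<Rightarrow> tree list \<Rightarrow> expr list \<Rightarrow> tree list \<Rightarrow> nat \<Rightarrow> bool"
  for P :: program where
  eval_Var: "i < length \<eta> \<Longrightarrow> eval P \<eta> (EVar i) (\<eta> ! i) 1"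
| eval_Atom: "eval P \<eta> EAtom Atom 1"
| eval_Cons: "eval P \<eta> e1 v1 t1 \<Longrightarrow> eval P \<eta> e2 v2 t2 \<Longrightarrow>
    eval P \<eta> (ECons e1 e2) (Cell v1 v2) (t1 + t2 + 1)"
| eval_Hd: "eval P \<eta> e v t \<Longrightarrow> eval P \<eta> (EHd e) (head v) (t + 1)"
| eval_Tl: "eval P \<eta> e v t \<Longrightarrow> eval P \<eta> (ETl e) (tail v) (t + 1)"
| eval_If_then: "eval P \<eta> b u t1 \<Longrightarrow> u \<noteq> Atom \<Longrightarrow> eval P \<eta> e1 v t2 \<Longrightarrow>
    eval P \<eta> (EIf b e1 e2) v (t1 + t2 + 1)"
| eval_If_else: "eval P \<eta> b Atom t1 \<Longrightarrow> eval P \<eta> e2 v t2 \<Longrightarrow>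
    eval P \<eta> (EIf b e1 e2) v (t1 + t2 + 1)"
| eval_Call: "f < length P \<Longrightarrow> evals P \<eta> es vs t1 \<Longrightarrow> eval P vs (P ! f) v t2 \<Longrightarrow>
    eval P \<eta> (ECall f es) v (t1 + t2 + 1)"
| evals_Nil: "evals P \<eta> [] [] 0"
| evals_Cons: "eval P \<eta> e v t1 \<Longrightarrow> evals P \<eta> es vs t2 \<Longrightarrow>
    evals P \<eta> (e # es) (v # vs) (t1 + t2)"

inductive_cases eval_VarE: "eval P \<eta> (EVar i) v t"
inductive_cases eval_AtomE: "eval P \<eta> EAtom v t"
inductive_cases eval_ConsE: "eval P \<eta> (ECons e1 e2) v t"
inductive_cases eval_HdE: "eval P \<eta> (EHd e) v t"
inductive_cases eval_TlE: "eval P \<eta> (ETl e) v t"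
inductive_cases eval_IfE: "eval P \<eta> (EIf b e1 e2) v t"
inductive_cases eval_CallE: "eval P \<eta> (ECall f es) v t"
inductive_cases evals_NilE: "evals P \<eta> [] vs t"
inductive_cases evals_ConsE: "evals P \<eta> (e # es) vs t"

lemma eval_deterministic:
  "eval P \<eta> e v t \<Longrightarrow> eval P \<eta> e v' t' \<Longrightarrow> v' = v \<and> t' = t"
  "evals P \<eta> es vs t \<Longrightarrow> evals P \<eta> es vs' t' \<Longrightarrow> vs' = vs \<and> t' = t"
proof (induction arbitrary: v' t' and vs' t' rule: eval_evals.inducts)
  case eval_Var from eval_Var.prems show ?case by (rule eval_VarE) simp
next
  case eval_Atom from eval_Atom.prems show ?case by (rule eval_AtomE) simp
next
  case eval_Cons from eval_Cons.prems show ?case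
    by (rule eval_ConsE, simp, metis eval_Cons)
next
  case eval_Hd from eval_Hd.prems show ?case
    by (rule eval_HdE, simp, metis eval_Hd)
next
  case eval_Tl from eval_Tl.prems show ?case
    by (rule eval_TlE, simp, metis eval_Tl)
next
  case eval_If_then from eval_If_then.prems show ?case
    by (rule eval_IfE; simp; metis eval_If_then)
next
  case eval_If_else from eval_If_else.prems show ?case
    by (rule eval_IfE; simp; metis eval_If_else)
next
  case eval_Call from eval_Call.prems show ?case
    by (rule eval_CallE, simp, metis eval_Call)
next
  case evals_Nil from evals_Nil.prems show ?case by (rule evals_NilE) simp
next
  case evals_Cons from evals_Cons.prems show ?case
    by (rule evals_ConsE, simp, metis evals_Cons)
qed

text \<open>The function with index 0 is the main function.\<close>

definition computes_in :: "program \<Rightarrow> tree \<Rightarrow> tree \<Rightarrow> nat \<Rightarrow> bool" where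
  "computes_in P x y t \<longleftrightarrow> P \<noteq> [] \<and> eval P [x] (P ! 0) y t"


section \<open>Input and output\<close>

fun encode_list :: "('a \<Rightarrow> tree) \<Rightarrow> 'a list \<Rightarrow> tree" where
  "encode_list enc [] = Atom"
| "encode_list enc (x # xs) = Cell (enc x) (encode_list enc xs)"

fun encode_bool :: "bool \<Rightarrow> tree" where
  "encode_bool False = Atom"
| "encode_bool True = Cell Atom Atom"

text \<open>Binary digits, least significant first.\<close>

fun bits :: "nat \<Rightarrow> bool list" where
  "bits n = (if n = 0 then [] else odd n # bits (n div 2))"

declare bits.simps [simp del]

definition encode_nat :: "nat \<Rightarrow> tree" where
  "encode_nat n = encode_list encode_bool (bits n)"

text \<open>
  A formula is presented as a list of clauses, each a list of variables, without repetitions. The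
  variables are numbered \<open>0, \<dots>, |V(F)| - 1\<close> (by \<open>\<nu>\<close>) and written in binary. The numbering and the
  order within the lists are arbitrary, so a formula has many encodings.
\<close>

definition encodes :: "tree \<Rightarrow> 'v formula \<Rightarrow> bool" where
  "encodes x F \<longleftrightarrow>
     (\<exists>\<nu> Cs.
        bij_betw \<nu> (vars F) {..<card (vars F)} \<and>
        (\<forall>C\<in>set Cs. distinct C) \<and>
        distinct (map set Cs) \<and> set (map set Cs) = (\<lambda>C. \<nu> ` C) ` F \<and>
        x = encode_list (encode_list encode_nat) Cs)"

end

theory Submission
  imports Defs
begin

text \<open>
  Choosing true variables one by one, always for the first clause that is not yet covered, leads
  through states that are determined by the set of uncovered clauses. If the clauses are listed in
  breadth-first order along shared variables, every state contains all clauses from two levels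
  above its first clause onwards, and no clause before the first one; hence there are at most
  \<open>|F| * 2^b\<close> states, where \<open>b\<close> bounds the size of two consecutive levels.

  In an entangled chain, adjacent clauses belong to links at distance at most 2, and clauses of such
  links are joined by a walk of bounded length (as soon as \<open>k \<ge> 5\<close>). So a level meets only
  boundedly many links, and \<open>b = O(m)\<close> with \<open>m = |G|\<close>. Since any two clauses of \<open>G\<close> intersect,
  \<open>m \<le> k l\<close>, and \<open>k m = l n\<close> gives \<open>m \<le> l sqrt n\<close>. The search is therefore polynomial in \<open>n\<close> times
  \<open>2^O(sqrt n)\<close>. For \<open>l = 1\<close> the clauses of the chain are disjoint, and it is always x-satisfiable.
\<close>

section \<open>Bounded evaluation\<close>

text \<open>The program sees only a list of clauses: it recovers neither \<open>G\<close> nor the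
  links nor the positions of the swaps, and its correctness rests on none of them. The chain
  structure enters only the time analysis, through a level function that the program never computes
  but by which the list built by \<open>layered\<close> is sorted. States may be merged because the
  uncovered clauses alone show whether a variable can still be set to true. The obstacle is that a
  level might spread along the whole chain. A shortest walk to a distant clause must pass close to
  every link on its way; if nearby clauses are joined by bounded walks, all clauses on one side of
  the start that lie on two consecutive levels therefore have links in a bounded window. Walks
  inside a link can be blocked by swaps. At most two swaps affect a link, and each spoils at most
  two variables of a clause, so a fifth variable gives a way out: hence \<open>k \<ge> 5\<close>.
  For \<open>l \<ge> 2\<close> there are at least two variables, so \<open>ln n\<close> is bounded
  away from 0 and the final exponential absorbs the polynomial factors.\<close>

definition evb :: "program \<Rightarrow> tree list \<Rightarrow> expr \<Rightarrow> tree \<Rightarrow> nat \<Rightarrow> bool" where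
  "evb P \<eta> e v b \<longleftrightarrow> (\<exists>t\<le>b. eval P \<eta> e v t)"

definition evbs :: "program \<Rightarrow> tree list \<Rightarrow> expr list \<Rightarrow> tree list \<Rightarrow> nat \<Rightarrow> bool" where
  "evbs P \<eta> es vs b \<longleftrightarrow> (\<exists>t\<le>b. evals P \<eta> es vs t)"

definition run :: "program \<Rightarrow> nat \<Rightarrow> tree list \<Rightarrow> tree \<Rightarrow> nat \<Rightarrow> bool" where
  "run P f vs v b \<longleftrightarrow> f < length P \<and> evb P vs (P ! f) v b"

lemma evb_weaken: "evb P \<eta> e v t \<Longrightarrow> t \<le> b \<Longrightarrow> evb P \<eta> e v b"
  unfolding evb_def by (meson le_trans)

lemma run_weaken: "run P f vs v t \<Longrightarrow> t \<le> b \<Longrightarrow> run P f vs v b"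
  unfolding run_def using evb_weaken by blast

text \<open>In these rules the value is fixed by a separate equation. Applied backwards to a body
  they execute it symbolically: unification assembles the time bound, and simp settles the
  equations.\<close>

lemma evb_Var: "i < length \<eta> \<Longrightarrow> v = \<eta> ! i \<Longrightarrow> evb P \<eta> (EVar i) v 1"
  unfolding evb_def using eval_Var by blast

lemma evb_Atom: "v = Atom \<Longrightarrow> evb P \<eta> EAtom v 1"
  unfolding evb_def using eval_Atom by blast

lemma evb_Cons:
  "evb P \<eta> e1 v1 t1 \<Longrightarrow> evb P \<eta> e2 v2 t2 \<Longrightarrow> v = Cell v1 v2 \<Longrightarrow>
    evb P \<eta> (ECons e1 e2) v (t1 + t2 + 1)"
  unfolding evb_def by (metis add_le_mono add_le_mono1 eval_Cons)

lemma evb_Hd: "evb P \<eta> e u t \<Longrightarrow> v = head u \<Longrightarrow> evb P \<eta> (EHd e) v (t + 1)"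
  unfolding evb_def by (metis add_le_mono1 eval_Hd)

lemma evb_Tl: "evb P \<eta> e u t \<Longrightarrow> v = tail u \<Longrightarrow> evb P \<eta> (ETl e) v (t + 1)"
  unfolding evb_def by (metis add_le_mono1 eval_Tl)

text \<open>One rule for both outcomes: once \<open>u\<close> is known, simp resolves the equation
  for \<open>e\<close>, and only the branch taken is evaluated.\<close>

lemma evb_If:
  assumes "evb P \<eta> b u t1" "e = (if u = Atom then e2 else e1)" "evb P \<eta> e v t2"
  shows "evb P \<eta> (EIf b e1 e2) v (t1 + t2 + 1)"
proof -
  obtain s1 s2 where s: "s1 \<le> t1" "eval P \<eta> b u s1" "s2 \<le> t2" "eval P \<eta> e v s2"
    using assms(1,3) unfolding evb_def by blast
  have "eval P \<eta> (EIf b e1 e2) v (s1 + s2 + 1)"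
    using s assms(2) eval_If_then[of P \<eta> b u s1 e1 v s2 e2] eval_If_else[of P \<eta> b s1 e2 v s2 e1]
    by (cases "u = Atom") auto
  moreover have "s1 + s2 + 1 \<le> t1 + t2 + 1" using s by simp
  ultimately show ?thesis unfolding evb_def by blast
qed

lemma evb_Call:
  assumes "evbs P \<eta> es vs t1" "run P f vs v t2"
  shows "evb P \<eta> (ECall f es) v (t1 + t2 + 1)"
proof -
  obtain s1 s2 where s: "s1 \<le> t1" "evals P \<eta> es vs s1" "s2 \<le> t2" "eval P vs (P ! f) v s2"
    and f: "f < length P"
    using assms unfolding evb_def evbs_def run_def by blast
  have "eval P \<eta> (ECall f es) v (s1 + s2 + 1)" using eval_Call s f by blast
  moreover have "s1 + s2 + 1 \<le> t1 + t2 + 1" using s by simp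
  ultimately show ?thesis unfolding evb_def by blast
qed

lemma evbs_Nil: "vs = [] \<Longrightarrow> evbs P \<eta> [] vs 0"
  unfolding evbs_def using evals_Nil by blast

lemma evbs_Cons:
  "evb P \<eta> e v t1 \<Longrightarrow> evbs P \<eta> es vs t2 \<Longrightarrow> ws = v # vs \<Longrightarrow> evbs P \<eta> (e # es) ws (t1 + t2)"
  unfolding evb_def evbs_def by (metis add_le_mono evals_Cons)

lemmas evb_rules = evb_Var evb_Atom evb_Cons evb_Hd evb_Tl evb_If evbs_Nil evbs_Cons evb_Call


section \<open>Encodings\<close>

lemma inj_encode_bool: "inj encode_bool"
proof (rule injI)
  fix a b show "encode_bool a = encode_bool b \<Longrightarrow> a = b" by (cases a; cases b) auto
qed

lemma encode_bool_eq_Atom [simp]: "encode_bool b = Atom \<longleftrightarrow> \<not> b"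
  by (cases b) auto

lemma encode_list_eq_Atom [simp]: "encode_list enc xs = Atom \<longleftrightarrow> xs = []"
  by (cases xs) auto

lemma inj_encode_list:
  assumes "inj enc"
  shows "inj (encode_list enc)"
proof (rule injI)
  fix xs ys show "encode_list enc xs = encode_list enc ys \<Longrightarrow> xs = ys"
  proof (induction xs arbitrary: ys)
    case Nil
    then show ?case by (metis encode_list.simps(1) encode_list_eq_Atom)
  next
    case (Cons x xs)
    then show ?case using assms by (cases ys) (auto dest: injD)
  qed
qed

lemma inj_bits: "inj bits"
proof (rule injI)
  fix m n show "bits m = bits n \<Longrightarrow> m = n"
  proof (induction m arbitrary: n rule: less_induct)
    case (less m)
    show ?case
    proof (cases "m = 0 \<or> n = 0")
      case True
      then show ?thesis using less.prems by (auto simp: bits.simps[of m] bits.simps[of n] split: if_splits)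
    next
      case False
      then have "odd m = odd n" "bits (m div 2) = bits (n div 2)"
        using less.prems by (simp_all add: bits.simps[of m] bits.simps[of n])
      moreover have "m div 2 < m" using False by simp
      ultimately have "m div 2 = n div 2" "odd m = odd n" using less.IH by blast+
      then show ?thesis by (metis even_two_times_div_two odd_two_times_div_two_succ)
    qed
  qed
qed

lemma inj_encode_nat: "inj encode_nat"
proof -
  have "encode_nat = encode_list encode_bool \<circ> bits" by (auto simp: encode_nat_def)
  then show ?thesis using inj_compose inj_encode_list inj_encode_bool inj_bits by metis
qed

abbreviation encode_clause :: "nat list \<Rightarrow> tree" where
  "encode_clause \<equiv> encode_list encode_nat"

abbreviation encode_cnf :: "nat list list \<Rightarrow> tree" where
  "encode_cnf \<equiv> encode_list encode_clause"

lemma inj_encode_cnf: "inj encode_cnf"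
  by (simp_all add: inj_encode_list inj_encode_nat)

section \<open>Sizes of encodings\<close>

lemma size_encode_list: "size (encode_list enc xs) = (\<Sum>x\<leftarrow>xs. size (enc x) + 1)"
  by (induction xs) auto

lemma length_le_size: "length xs \<le> size (encode_list enc xs)"
  by (induction xs) auto

lemma size_member_less: "x \<in> set xs \<Longrightarrow> size (enc x) < size (encode_list enc xs)"
  by (induction xs) auto

lemma size_filter_le: "size (encode_list enc (filter Q xs)) \<le> size (encode_list enc xs)"
  by (induction xs) auto

lemma length_bits_le: "length (bits n) \<le> n"
proof (induction n rule: less_induct)
  case (less n)
  show ?case
  proof (cases "n = 0")
    case False
    then have "length (bits (n div 2)) \<le> n div 2" using less by simp
    then show ?thesis using False by (subst bits.simps) simp
  qed (simp add: bits.simps)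
qed

text \<open>A digit contributes at most two cells. Counting \<open>n\<close> digits is crude for
  binary notation, but a polynomial bound on the input size suffices.\<close>

lemma size_encode_nat_le: "size (encode_nat n) \<le> 2 * n"
proof -
  have "size (encode_list encode_bool bs) \<le> 2 * length bs" for bs
  proof (induction bs)
    case (Cons b bs)
    then show ?case by (cases b) auto
  qed simp
  then have "size (encode_nat n) \<le> 2 * length (bits n)" by (simp add: encode_nat_def)
  then show ?thesis using length_bits_le[of n] by linarith
qed


section \<open>The search\<close>

definition touches :: "nat list list \<Rightarrow> nat list \<Rightarrow> bool" where
  "touches L c \<longleftrightarrow> (\<exists>d\<in>set L. set c \<inter> set d \<noteq> {})"

abbreviation near :: "nat list list \<Rightarrow> nat list list \<Rightarrow> nat list list" where
  "near L \<equiv> filter (touches L)"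

abbreviation far :: "nat list list \<Rightarrow> nat list list \<Rightarrow> nat list list" where
  "far L \<equiv> filter (\<lambda>c. \<not> touches L c)"

text \<open>\<open>L\<close> is the current breadth-first layer and \<open>R\<close> the clauses not
  reached so far. If the search gets stuck, the rest of \<open>R\<close> is appended, so no clause
  is lost on a disconnected input.\<close>

function layered :: "nat list list \<Rightarrow> nat list list \<Rightarrow> nat list list" where
  "layered L R = (if near L R = [] then L @ R else L @ layered (near L R) (far L R))"
  by auto
termination
proof (relation "measure (length \<circ> snd)")
  fix L R :: "nat list list" assume "near L R \<noteq> []"
  then obtain c where "c \<in> set R" "touches L c" by (auto simp: filter_empty_conv)
  then have "length (far L R) < length R" by (metis length_filter_less)
  then show "((near L R, far L R), L, R) \<in> measure (length \<circ> snd)" by simp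
qed simp

declare layered.simps [simp del]

text \<open>Merging equal states is what turns a bound on distinct states into a time bound. All
  states are sublists of one list in the same order, so comparing them as lists is adequate.\<close>

definition ins :: "'a \<Rightarrow> 'a list \<Rightarrow> 'a list" where
  "ins x xs = (if x \<in> set xs then xs else x # xs)"

text \<open>A state is the list of the clauses not yet covered. Setting \<open>v\<close> to true is admissible iff no
  clause with \<open>v\<close> has been covered before, that is, iff all of them are still in the state.\<close>

fun branch :: "nat list list \<Rightarrow> nat list list \<Rightarrow> nat list \<Rightarrow> nat list list list \<Rightarrow> nat list list list" where
  "branch F S [] acc = acc"
| "branch F S (v # vs) acc =
    branch F S vs (if near [[v]] S = near [[v]] F then ins (far [[v]] S) acc else acc)"

text \<open>The empty state stands for a finished solution. It is passed on unchanged, so a solution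
  found early survives to the last round.\<close>

fun step :: "nat list list \<Rightarrow> nat list list list \<Rightarrow> nat list list list \<Rightarrow> nat list list list" where
  "step F [] acc = acc"
| "step F (S # Ss) acc = step F Ss (case S of [] \<Rightarrow> ins [] acc | c # _ \<Rightarrow> branch F S c acc)"

text \<open>The fuel is a unary counter of which only the length matters. The program uses the
  clause list itself, one round per clause.\<close>

fun iterate :: "nat list list \<Rightarrow> 'a list \<Rightarrow> nat list list list \<Rightarrow> nat list list list" where
  "iterate F [] Ss = Ss"
| "iterate F (_ # fuel) Ss = iterate F fuel (step F Ss [])"

text \<open>Accumulators never shrink, so a bound on the final list also bounds every insertion on
  the way.\<close>

lemma length_branch: "length acc \<le> length (branch F S vs acc)"
proof (induction vs arbitrary: acc)
  case (Cons v vs)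
  have "length acc \<le> length (if near [[v]] S = near [[v]] F then ins (far [[v]] S) acc else acc)"
    by (simp add: ins_def)
  then show ?case using Cons.IH order_trans by fastforce
qed simp

lemma length_step: "length acc \<le> length (step F Ss acc)"
proof (induction Ss arbitrary: acc)
  case (Cons S Ss)
  have "length acc \<le> length (case S of [] \<Rightarrow> ins [] acc | c # _ \<Rightarrow> branch F S c acc)"
    by (auto simp: ins_def length_branch split: list.split)
  then show ?case using Cons.IH order_trans by fastforce
qed simp


section \<open>The program\<close>

definition "MAIN = (0::nat)"
definition "START = (1::nat)"
definition "EQ = (2::nat)"
definition "MEM = (3::nat)"
definition "MEETS = (4::nat)"
definition "TOUCHES = (5::nat)"
definition "NEAR = (6::nat)"
definition "FAR = (7::nat)"
definition "APPEND = (8::nat)"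
definition "LAYERED = (9::nat)"
definition "INS = (10::nat)"
definition "BRANCH = (11::nat)"
definition "STEP = (12::nat)"
definition "ITERATE = (13::nat)"

text \<open>The arguments \<open>EVar 0, EVar 1, \<dots>\<close> are, in this order, \<open>x\<close> for \<open>MAIN\<close>, \<open>F\<close> for \<open>START\<close>,
  \<open>L, c\<close> for \<open>TOUCHES\<close>, \<open>L, R\<close> for \<open>NEAR\<close>, \<open>FAR\<close> and \<open>LAYERED\<close>, \<open>F, S, vs, acc\<close> for \<open>BRANCH\<close>,
  \<open>F, Ss, acc\<close> for \<open>STEP\<close>, and \<open>F, fuel, Ss\<close> for \<open>ITERATE\<close>.\<close>

abbreviation "ETrue \<equiv> ECons EAtom EAtom"

text \<open>The surviving list is returned without a final test: the only possible outcomes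
  \<open>[[]]\<close> and \<open>[]\<close> have the same encodings as \<open>True\<close> and
  \<open>False\<close>.\<close>

definition main_body :: expr where
  "main_body =
    ECall START [ECall LAYERED [ECons (EHd (EVar 0)) EAtom, ETl (EVar 0)]]"

text \<open>A separate function replaces a let: the layered list is needed as formula, as fuel and
  as initial state.\<close>

definition start_body :: expr where
  "start_body =
    ECall ITERATE [EVar 0, EVar 0, ECons (EVar 0) EAtom]"

definition eq_body :: expr where
  "eq_body =
    EIf (EVar 0)
      (EIf (EVar 1)
        (EIf (ECall EQ [EHd (EVar 0), EHd (EVar 1)]) (ECall EQ [ETl (EVar 0), ETl (EVar 1)]) EAtom)
        EAtom)
      (EIf (EVar 1) EAtom ETrue)"

definition mem_body :: expr where
  "mem_body =
    EIf (EVar 1)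
      (EIf (ECall EQ [EVar 0, EHd (EVar 1)]) ETrue (ECall MEM [EVar 0, ETl (EVar 1)]))
      EAtom"

definition meets_body :: expr where
  "meets_body =
    EIf (EVar 0)
      (EIf (ECall MEM [EHd (EVar 0), EVar 1]) ETrue (ECall MEETS [ETl (EVar 0), EVar 1]))
      EAtom"

definition touches_body :: expr where
  "touches_body =
    EIf (EVar 0)
      (EIf (ECall MEETS [EVar 1, EHd (EVar 0)]) ETrue (ECall TOUCHES [ETl (EVar 0), EVar 1]))
      EAtom"

definition near_body :: expr where
  "near_body =
    EIf (EVar 1)
      (EIf (ECall TOUCHES [EVar 0, EHd (EVar 1)])
        (ECons (EHd (EVar 1)) (ECall NEAR [EVar 0, ETl (EVar 1)]))
        (ECall NEAR [EVar 0, ETl (EVar 1)]))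
      EAtom"

definition far_body :: expr where
  "far_body =
    EIf (EVar 1)
      (EIf (ECall TOUCHES [EVar 0, EHd (EVar 1)])
        (ECall FAR [EVar 0, ETl (EVar 1)])
        (ECons (EHd (EVar 1)) (ECall FAR [EVar 0, ETl (EVar 1)])))
      EAtom"

definition append_body :: expr where
  "append_body =
    EIf (EVar 0)
      (ECons (EHd (EVar 0)) (ECall APPEND [ETl (EVar 0), EVar 1]))
      (EVar 1)"

definition layered_body :: expr where
  "layered_body =
    EIf (ECall NEAR [EVar 0, EVar 1])
      (ECall APPEND [EVar 0,
        ECall LAYERED [ECall NEAR [EVar 0, EVar 1], ECall FAR [EVar 0, EVar 1]]])
      (ECall APPEND [EVar 0, EVar 1])"

definition ins_body :: expr where
  "ins_body =
    EIf (ECall MEM [EVar 0, EVar 1]) (EVar 1) (ECons (EVar 0) (EVar 1))"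

text \<open>With the one-variable list \<open>[[v]]\<close>, \<open>NEAR\<close> and
  \<open>FAR\<close> select the clauses with and without \<open>v\<close>.\<close>

definition branch_body :: expr where
  "branch_body =
    EIf (EVar 2)
      (ECall BRANCH [EVar 0, EVar 1, ETl (EVar 2),
        EIf (ECall EQ [ECall NEAR [ECons (ECons (EHd (EVar 2)) EAtom) EAtom, EVar 1],
                       ECall NEAR [ECons (ECons (EHd (EVar 2)) EAtom) EAtom, EVar 0]])
          (ECall INS [ECall FAR [ECons (ECons (EHd (EVar 2)) EAtom) EAtom, EVar 1], EVar 3])
          (EVar 3)])
      (EVar 3)"

definition step_body :: expr where
  "step_body =
    EIf (EVar 1)
      (ECall STEP [EVar 0, ETl (EVar 1),
        EIf (EHd (EVar 1))
          (ECall BRANCH [EVar 0, EHd (EVar 1), EHd (EHd (EVar 1)), EVar 2])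
          (ECall INS [EAtom, EVar 2])])
      (EVar 2)"

definition iterate_body :: expr where
  "iterate_body =
    EIf (EVar 1)
      (ECall ITERATE [EVar 0, ETl (EVar 1), ECall STEP [EVar 0, EVar 2, EAtom]])
      (EVar 2)"

definition prog :: program where
  "prog = [main_body, start_body, eq_body, mem_body, meets_body, touches_body, near_body, far_body, append_body, layered_body, ins_body, branch_body, step_body, iterate_body]"

lemmas index_defs = MAIN_def START_def EQ_def MEM_def MEETS_def TOUCHES_def NEAR_def FAR_def
  APPEND_def LAYERED_def INS_def BRANCH_def STEP_def ITERATE_def

lemma index_less [simp]:
  "MAIN < length prog" "START < length prog" "EQ < length prog" "MEM < length prog"
  "MEETS < length prog" "TOUCHES < length prog" "NEAR < length prog" "FAR < length prog"
  "APPEND < length prog" "LAYERED < length prog" "INS < length prog" "BRANCH < length prog"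
  "STEP < length prog" "ITERATE < length prog"
  by (simp_all add: index_defs prog_def)

lemma nth_prog:
  "prog ! MAIN = main_body"
  "prog ! START = start_body"
  "prog ! EQ = eq_body"
  "prog ! MEM = mem_body"
  "prog ! MEETS = meets_body"
  "prog ! TOUCHES = touches_body"
  "prog ! NEAR = near_body"
  "prog ! FAR = far_body"
  "prog ! APPEND = append_body"
  "prog ! LAYERED = layered_body"
  "prog ! INS = ins_body"
  "prog ! BRANCH = branch_body"
  "prog ! STEP = step_body"
  "prog ! ITERATE = iterate_body"
  by (simp_all add: index_defs prog_def)


section \<open>Running times\<close>

lemmas code = nth_prog[unfolded main_body_def start_body_def eq_body_def mem_body_def
  meets_body_def touches_body_def near_body_def far_body_def append_body_def layered_body_def
  ins_body_def branch_body_def step_body_def iterate_body_def]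

text \<open>The bound \<open>t\<close> stays schematic while the body is executed; the last premise
  then compares it with the claimed \<open>b\<close>.\<close>

lemma runI:
  "P ! f = e \<Longrightarrow> f < length P \<Longrightarrow> evb P vs e v t \<Longrightarrow> t \<le> b \<Longrightarrow> run P f vs v b"
  unfolding run_def using evb_weaken by blast

text \<open>Both trees are descended in parallel and the comparison stops where \<open>a\<close>
  ends, so the size of \<open>b\<close> does not enter.\<close>

lemma run_eq: "run prog EQ [a, b] (encode_bool (a = b)) (30 * size a + 10)"
proof (induction a arbitrary: b)
  case Atom
  show ?case
  proof (cases b)
    case Atom
    then show ?thesis by (intro runI[OF code(3)]) (rule evb_rules | simp)+
  next
    case (Cell b1 b2)
    then show ?thesis by (intro runI[OF code(3)]) (rule evb_rules | simp)+
  qed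
next
  case (Cell a1 a2)
  show ?case
  proof (cases b)
    case Atom
    then show ?thesis by (intro runI[OF code(3)]) (rule evb_rules | simp)+
  next
    case b: (Cell b1 b2)
    \<comment> \<open>Naming the outcome of the test before splitting on it makes
      \<open>encode_bool e\<close> a constant in each case, so the conditional can be executed
      symbolically. The same device recurs in the lemmas below.\<close>
    obtain e where e: "(a1 = b1) = e" by simp
    note run = Cell.IH(1)[of b1, unfolded e] Cell.IH(2)[of b2]
    show ?thesis unfolding b
      by (cases e; intro runI[OF code(3)]) (rule evb_rules run | simp add: e)+
  qed
qed

text \<open>Injectivity turns equality of trees into equality of elements. As the cost of
  \<open>EQ\<close> depends on its first argument only, the sizes of the list entries do not
  appear.\<close>

lemma run_mem:
  assumes "inj enc"
  shows "run prog MEM [enc x, encode_list enc xs] (encode_bool (x \<in> set xs))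
    ((30 * size (enc x) + 30) * (length xs + 1))"
proof (induction xs)
  case Nil
  show ?case by (intro runI[OF code(4)]) (rule evb_rules | simp)+
next
  case (Cons y ys)
  obtain e where e: "(x = y) = e" by simp
  have "enc x = enc y \<longleftrightarrow> e" using assms e by (auto dest: injD)
  note run = Cons.IH run_eq[of "enc x" "enc y", unfolded this]
  show ?case
    by (cases e; intro runI[OF code(4)]) (rule evb_rules run | simp add: e)+
qed

text \<open>The cost \<open>T\<close> of the inner test is a parameter here and in the next loops;
  the nested bounds are made explicit once, in \<open>near_far_time\<close>.\<close>

lemma run_meets:
  assumes "\<And>v. v \<in> set c \<Longrightarrow>
    run prog MEM [encode_nat v, encode_clause d] (encode_bool (v \<in> set d)) T"
  shows "run prog MEETS [encode_clause c, encode_clause d] (encode_bool (set c \<inter> set d \<noteq> {}))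
    ((T + 20) * (length c + 1))"
  using assms
proof (induction c)
  case Nil
  show ?case by (intro runI[OF code(5)]) (rule evb_rules | simp)+
next
  case (Cons v c)
  obtain e where e: "(v \<in> set d) = e" by simp
  note run = Cons.prems[of v, unfolded e, simplified] Cons.IH[OF Cons.prems, simplified]
  show ?case
    by (cases e; intro runI[OF code(5)]) (rule evb_rules run | simp add: e)+
qed

lemma run_touches:
  assumes "\<And>d. d \<in> set L \<Longrightarrow>
    run prog MEETS [encode_clause c, encode_clause d] (encode_bool (set c \<inter> set d \<noteq> {})) T"
  shows "run prog TOUCHES [encode_cnf L, encode_clause c] (encode_bool (touches L c))
    ((T + 20) * (length L + 1))"
  using assms
proof (induction L)
  case Nil
  show ?case by (intro runI[OF code(6)]) (rule evb_rules | simp add: touches_def)+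
next
  case (Cons d L)
  obtain e where e: "(set c \<inter> set d \<noteq> {}) = e" by simp
  have t: "touches (d # L) c = (e \<or> touches L c)" using e by (auto simp: touches_def)
  note run = Cons.prems[of d, unfolded e, simplified] Cons.IH[OF Cons.prems, simplified]
  show ?case
    by (cases e; intro runI[OF code(6)]) (rule evb_rules run | simp add: t)+
qed

lemma run_near:
  assumes "\<And>c. c \<in> set R \<Longrightarrow>
    run prog TOUCHES [encode_cnf L, encode_clause c] (encode_bool (touches L c)) T"
  shows "run prog NEAR [encode_cnf L, encode_cnf R] (encode_cnf (near L R))
    ((T + 20) * (length R + 1))"
  using assms
proof (induction R)
  case Nil
  show ?case by (intro runI[OF code(7)]) (rule evb_rules | simp)+
next
  case (Cons c R)
  obtain e where e: "touches L c = e" by simp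
  note run = Cons.prems[of c, unfolded e, simplified] Cons.IH[OF Cons.prems, simplified]
  show ?case
    by (cases e; intro runI[OF code(7)]) (rule evb_rules run | simp add: e)+
qed

lemma run_far:
  assumes "\<And>c. c \<in> set R \<Longrightarrow>
    run prog TOUCHES [encode_cnf L, encode_clause c] (encode_bool (touches L c)) T"
  shows "run prog FAR [encode_cnf L, encode_cnf R] (encode_cnf (far L R))
    ((T + 20) * (length R + 1))"
  using assms
proof (induction R)
  case Nil
  show ?case by (intro runI[OF code(8)]) (rule evb_rules | simp)+
next
  case (Cons c R)
  obtain e where e: "touches L c = e" by simp
  note run = Cons.prems[of c, unfolded e, simplified] Cons.IH[OF Cons.prems, simplified]
  show ?case
    by (cases e; intro runI[OF code(8)]) (rule evb_rules run | simp add: e)+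
qed

lemma run_append:
  "run prog APPEND [encode_list enc xs, encode_list enc ys] (encode_list enc (xs @ ys))
    (20 * (length xs + 1))"
proof (induction xs)
  case Nil
  show ?case by (intro runI[OF code(9)]) (rule evb_rules | simp)+
next
  case (Cons x xs)
  show ?case by (intro runI[OF code(9)]) (rule evb_rules Cons.IH | simp)+
qed

lemma run_ins:
  assumes "inj enc"
  shows "run prog INS [enc x, encode_list enc xs] (encode_list enc (ins x xs))
    ((30 * size (enc x) + 40) * (length xs + 1))"
proof -
  obtain e where e: "(x \<in> set xs) = e" by simp
  note run = run_mem[OF assms, of x xs, unfolded e]
  show ?thesis
    by (cases e; intro runI[OF code(11)]) (rule evb_rules run | simp add: ins_def e algebra_simps)+
qed

text \<open>The exponent 5 comes from a linear tree comparison inside four nested loops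
  (\<open>MEM\<close>, \<open>MEETS\<close>, \<open>TOUCHES\<close>, and \<open>NEAR\<close> or
  \<open>FAR\<close>), each over a list of length at most \<open>X\<close>.\<close>

lemma near_far_time:
  assumes L: "size (encode_cnf L) \<le> X" and R: "size (encode_cnf R) \<le> X"
  shows "run prog NEAR [encode_cnf L, encode_cnf R] (encode_cnf (near L R)) (90 * (X + 1) ^ 5)"
    and "run prog FAR [encode_cnf L, encode_cnf R] (encode_cnf (far L R)) (90 * (X + 1) ^ 5)"
proof -
  define Y where "Y = X + 1"
  have Y: "1 \<le> Y ^ i" for i by (simp add: Y_def)
  have pow: "Y ^ 3 = Y ^ 2 * Y" "Y ^ 4 = Y ^ 3 * Y" "Y ^ 5 = Y ^ 4 * Y"
    by (simp_all flip: power_Suc2)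
  have touches: "run prog TOUCHES [encode_cnf L, encode_clause c] (encode_bool (touches L c))
      (70 * Y ^ 4)" if c: "c \<in> set R" for c
  proof -
    have c_le: "size (encode_clause c) \<le> X"
      using size_member_less[OF c, of encode_clause] R by linarith
    have meets: "run prog MEETS [encode_clause c, encode_clause d]
        (encode_bool (set c \<inter> set d \<noteq> {})) (50 * Y ^ 3)" if d: "d \<in> set L" for d
    proof -
      have d_le: "size (encode_clause d) \<le> X"
        using size_member_less[OF d, of encode_clause] L by linarith
      have "run prog MEM [encode_nat v, encode_clause d] (encode_bool (v \<in> set d)) (30 * Y ^ 2)"
        if v: "v \<in> set c" for v
      proof (rule run_weaken[OF run_mem[OF inj_encode_nat]])
        have "size (encode_nat v) \<le> X" using size_member_less[OF v, of encode_nat] c_le by linarith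
        then have "(30 * size (encode_nat v) + 30) * (length d + 1) \<le> (30 * Y) * Y"
          using length_le_size[of d encode_nat] d_le unfolding Y_def by (intro mult_le_mono) auto
        then show "(30 * size (encode_nat v) + 30) * (length d + 1) \<le> 30 * Y ^ 2"
          by (simp add: power2_eq_square)
      qed
      then show ?thesis
      proof (rule run_weaken[OF run_meets])
        have "(30 * Y ^ 2 + 20) * (length c + 1) \<le> (50 * Y ^ 2) * Y"
          using length_le_size[of c encode_nat] c_le Y[of 2] unfolding Y_def
          by (intro mult_le_mono) auto
        then show "(30 * Y ^ 2 + 20) * (length c + 1) \<le> 50 * Y ^ 3"
          by (simp add: pow(1))
      qed
    qed
    then show ?thesis
    proof (rule run_weaken[OF run_touches])
      have "(50 * Y ^ 3 + 20) * (length L + 1) \<le> (70 * Y ^ 3) * Y"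
        using length_le_size[of L encode_clause] L Y[of 3] unfolding Y_def
        by (intro mult_le_mono) auto
      then show "(50 * Y ^ 3 + 20) * (length L + 1) \<le> 70 * Y ^ 4"
        by (simp add: pow(2))
    qed
  qed
  have le: "(70 * Y ^ 4 + 20) * (length R + 1) \<le> 90 * Y ^ 5"
  proof -
    have "(70 * Y ^ 4 + 20) * (length R + 1) \<le> (90 * Y ^ 4) * Y"
      using length_le_size[of R encode_clause] R Y[of 4] unfolding Y_def
      by (intro mult_le_mono) auto
    then show ?thesis by (simp add: pow(3))
  qed
  show "run prog NEAR [encode_cnf L, encode_cnf R] (encode_cnf (near L R)) (90 * (X + 1) ^ 5)"
    using run_weaken[OF run_near[OF touches] le] unfolding Y_def by blast
  show "run prog FAR [encode_cnf L, encode_cnf R] (encode_cnf (far L R)) (90 * (X + 1) ^ 5)"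
    using run_weaken[OF run_far[OF touches] le] unfolding Y_def by blast
qed

text \<open>Every recursive call has a nonempty \<open>near L R\<close> and so loses at least one
  clause of \<open>R\<close>. One call costs three filters, \<open>NEAR\<close> being evaluated
  twice, and an append.\<close>

lemma run_layered:
  assumes "size (encode_cnf L) \<le> X" "size (encode_cnf R) \<le> X"
  shows "run prog LAYERED [encode_cnf L, encode_cnf R] (encode_cnf (layered L R))
    (400 * (X + 1) ^ 5 * (length R + 1))"
  using assms
proof (induction L R rule: layered.induct)
  case (1 L R)
  define Z where "Z = (X + 1) ^ 5"
  have len: "length L \<le> Z"
  proof -
    have "length L \<le> (X + 1) ^ 1" using length_le_size[of L encode_clause] 1 by simp
    also have "\<dots> \<le> Z" unfolding Z_def by (rule power_increasing) auto
    finally show ?thesis .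
  qed
  have Z: "1 \<le> Z" by (simp add: Z_def)
  note time = near_far_time[OF 1(2,3), folded Z_def]
  show ?case unfolding Z_def[symmetric]
  proof (cases "near L R = []")
    case True
    note run = time[unfolded True] run_append
    show "run prog LAYERED [encode_cnf L, encode_cnf R] (encode_cnf (layered L R))
      (400 * Z * (length R + 1))"
      using len Z True layered.simps[of L R]
      by (intro runI[OF code(10)]) (rule evb_rules run | simp add: algebra_simps)+
  next
    case False
    have size: "size (encode_cnf (near L R)) \<le> X" "size (encode_cnf (far L R)) \<le> X"
      using size_filter_le[of encode_clause _ R] 1(3) order_trans by blast+
    have "length (far L R) + length (near L R) = length R"
      using sum_length_filter_compl[of "touches L" R] by simp
    moreover have "length (near L R) \<ge> 1" using False by (cases "near L R") auto
    ultimately have less: "length (far L R) + 1 \<le> length R" by linarith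
    then have le: "400 * Z * (length (far L R) + 1) \<le> 400 * Z * length R" by (rule mult_le_mono2)
    note rec = run_weaken[OF 1(1)[OF False size, folded Z_def] le]
    obtain N where N: "near L R = N" by simp
    obtain R' where R': "far L R = R'" by simp
    note run = time[unfolded N R'] rec[unfolded N R'] run_append
    show "run prog LAYERED [encode_cnf L, encode_cnf R] (encode_cnf (layered L R))
      (400 * Z * (length R + 1))"
      using len Z False layered.simps[of L R]
      by (intro runI[OF code(10)]) (rule evb_rules run | simp add: N R' algebra_simps)+
  qed
qed

text \<open>Layering only permutes clauses, so the bound on the input size carries over to the list
  on which the search runs.\<close>

lemma size_layered: "size (encode_cnf (layered L R)) = size (encode_cnf L) + size (encode_cnf R)"
proof (induction L R rule: layered.induct)
  case (1 L R)
  have "size (encode_cnf (filter p R)) + size (encode_cnf (filter (\<lambda>c. \<not> p c) R)) = size (encode_cnf R)"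
    for p by (induction R) auto
  then show ?case using 1 layered.simps[of L R] 
    by (auto simp: size_encode_list)
qed

text \<open>The \<open>+ 2\<close> leaves room for the two cells that wrap \<open>v\<close> into
  \<open>[[v]]\<close>. \<open>Q\<close> bounds the final accumulator and hence, by
  \<open>length_branch\<close>, all earlier ones.\<close>

lemma run_branch:
  assumes F: "size (encode_cnf F) \<le> X" and S: "size (encode_cnf S) \<le> X"
    and vs: "\<And>v. v \<in> set vs \<Longrightarrow> size (encode_nat v) + 2 \<le> X"
    and Q: "length (branch F S vs acc) \<le> Q"
  shows "run prog BRANCH [encode_cnf F, encode_cnf S, encode_clause vs, encode_list encode_cnf acc]
    (encode_list encode_cnf (branch F S vs acc)) (500 * ((X + 1) ^ 5 * (Q + 1)) * (length vs + 1))"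
proof -
  define Z where "Z = (X + 1) ^ 5"
  have Z: "1 \<le> Z" by (simp add: Z_def)
  have X_le: "X + 1 \<le> Z" unfolding Z_def using power_increasing[of 1 5 "X + 1"] by simp
  define B where "B = Z * (Q + 1)"
  have B: "Z \<le> B" by (simp add: B_def)
  show ?thesis using vs Q unfolding Z_def[symmetric] B_def[symmetric]
  proof (induction vs arbitrary: acc)
    case Nil
    show ?case using Z B by (intro runI[OF code(12)]) (rule evb_rules | simp)+
  next
    case (Cons v vs)
    obtain N where N: "near [[v]] S = N" by simp
    obtain N' where N': "near [[v]] F = N'" by simp
    obtain R where R: "far [[v]] S = R" by simp
    have N_le: "size (encode_cnf N) \<le> X" and R_le: "size (encode_cnf R) \<le> X"
      using size_filter_le[of encode_clause _ S] S order_trans unfolding N[symmetric] R[symmetric] by blast+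
    have "size (encode_cnf [[v]]) \<le> X" using Cons.prems(1)[of v] by simp
    note time = near_far_time[OF this F, folded Z_def] near_far_time[OF this S, folded Z_def]
    note time = time[simplified, unfolded N N' R]
    obtain e where e: "(N = N') = e" by simp
    have "encode_cnf N = encode_cnf N' \<longleftrightarrow> e" using e inj_encode_cnf by (auto dest: injD)
    note run_eq = run_eq[of "encode_cnf N" "encode_cnf N'", unfolded this]
    have "30 * size (encode_cnf N) + 10 \<le> 30 * Z" using N_le X_le by linarith
    note eq = run_weaken[OF run_eq this]
    define acc' where "acc' = (if e then ins R acc else acc)"
    have branch: "branch F S (v # vs) acc = branch F S vs acc'"
      by (simp add: N N' R e acc'_def)
    have "length acc \<le> Q"
      using Cons.prems(2) length_branch[of acc F S "v # vs"] by linarith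
    then have "(30 * size (encode_cnf R) + 40) * (length acc + 1) \<le> (30 * X + 40) * (Q + 1)"
      using R_le by (intro mult_le_mono) auto
    also have "\<dots> \<le> (70 * Z) * (Q + 1)" using X_le Z by (intro mult_le_mono) auto
    finally have "(30 * size (encode_cnf R) + 40) * (length acc + 1) \<le> 70 * B" by (simp add: B_def)
    note ins = run_weaken[OF run_ins[OF inj_encode_cnf] this]
    have "length (branch F S vs acc') \<le> Q" using Cons.prems(2) unfolding branch .
    from Cons.IH[OF Cons.prems(1) this]
    have rec: "run prog BRANCH [encode_cnf F, encode_cnf S, encode_clause vs, encode_list encode_cnf acc']
      (encode_list encode_cnf (branch F S vs acc')) (500 * B * (length vs + 1))" by simp
    show ?case
    proof (cases e)
      case True
      then have acc': "acc' = ins R acc" by (simp add: acc'_def)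
      note run = time eq ins rec[unfolded acc']
      show ?thesis unfolding branch acc'
        apply (intro runI[OF code(12)])
           apply (rule evb_rules run | (simp add: True; fail))+
        using Z B by (simp add: algebra_simps)
    next
      case False
      then have acc': "acc' = acc" by (simp add: acc'_def)
      note run = time eq rec[unfolded acc']
      show ?thesis unfolding branch acc'
        apply (intro runI[OF code(12)])
           apply (rule evb_rules run | (simp add: False; fail))+
        using Z B by (simp add: algebra_simps)
  qed
qed
qed

text \<open>The sixth factor \<open>X + 1\<close> bounds the number of variables in the first clause
  of a state, over which \<open>BRANCH\<close> loops.\<close>

lemma run_step:
  assumes F: "size (encode_cnf F) \<le> X"
    and Ss: "\<And>S. S \<in> set Ss \<Longrightarrow> size (encode_cnf S) \<le> X"
    and Q: "length (step F Ss acc) \<le> Q"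
  shows "run prog STEP [encode_cnf F, encode_list encode_cnf Ss, encode_list encode_cnf acc]
    (encode_list encode_cnf (step F Ss acc)) (600 * ((X + 1) ^ 6 * (Q + 1)) * (length Ss + 1))"
proof -
  define B where "B = (X + 1) ^ 6 * (Q + 1)"
  have B: "1 \<le> B" by (simp add: B_def Suc_le_eq)
  show ?thesis using Ss Q unfolding B_def[symmetric]
  proof (induction Ss arbitrary: acc)
    case Nil
    show ?case using B by (intro runI[OF code(13)]) (rule evb_rules | simp)+
  next
    case (Cons S Ss)
    have S_le: "size (encode_cnf S) \<le> X" using Cons.prems(1) by simp
    have step_le: "length acc' \<le> Q" "run prog STEP [encode_cnf F, encode_list encode_cnf Ss, encode_list encode_cnf acc']
        (encode_list encode_cnf (step F Ss acc')) (600 * B * (length Ss + 1))"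
      if "acc' = (case S of [] \<Rightarrow> ins [] acc | c # _ \<Rightarrow> branch F S c acc)" for acc'
    proof -
      have Q: "length (step F Ss acc') \<le> Q" using Cons.prems(2) that by simp
      then show "length acc' \<le> Q" using length_step[of acc' F Ss] by linarith
      show "run prog STEP [encode_cnf F, encode_list encode_cnf Ss, encode_list encode_cnf acc']
        (encode_list encode_cnf (step F Ss acc')) (600 * B * (length Ss + 1))"
        using Cons.IH[OF Cons.prems(1) Q] by simp
    qed
    show ?case
    proof (cases S)
      case Nil
      note rec = step_le(2)[of "ins [] acc", unfolded Nil, simplified]
      have "length (ins [] acc) \<le> Q" using step_le(1)[of "ins [] acc"] Nil by simp
      then have "length acc + 1 \<le> Q + 1" by (auto simp: ins_def split: if_splits)
      also have "\<dots> \<le> B" unfolding B_def by (metis le_add2 mult_le_mono1 mult_1 one_le_power)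
      finally have "(30 * size (encode_cnf []) + 40) * (length acc + 1) \<le> 40 * B" by simp
      note ins = run_weaken[OF run_ins[OF inj_encode_cnf] this, simplified]
      have step: "step F (S # Ss) acc = step F Ss (ins [] acc)" using Nil by simp
      note run = rec ins
      show ?thesis unfolding step
        apply (intro runI[OF code(13)])
           apply (rule evb_rules run | (simp add: Nil; fail))+
        using B by (simp add: algebra_simps)
    next
      case (Cons c S')
      note rec = step_le(2)[of "branch F S c acc", unfolded Cons, simplified, folded Cons]
      have Q: "length (branch F S c acc) \<le> Q" using step_le(1)[of "branch F S c acc"] Cons by simp
      have vs: "size (encode_nat v) + 2 \<le> X" if "v \<in> set c" for v
        using size_member_less[OF that, of encode_nat] S_le Cons by simp
      have "length c + 1 \<le> X + 1" using length_le_size[of c encode_nat] S_le Cons by simp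
      then have "500 * ((X + 1) ^ 5 * (Q + 1)) * (length c + 1) \<le> 500 * ((X + 1) ^ 5 * (Q + 1)) * (X + 1)"
        by (rule mult_le_mono2)
      also have "\<dots> = 500 * B" unfolding B_def using power_Suc2[of "X + 1" 5] by (simp add: algebra_simps)
      finally have "500 * ((X + 1) ^ 5 * (Q + 1)) * (length c + 1) \<le> 500 * B" .
      note branch = run_weaken[OF run_branch[OF F S_le vs Q] this]
      have step: "step F (S # Ss) acc = step F Ss (branch F S c acc)" using Cons by simp
      have S: "encode_cnf S = Cell (encode_clause c) (encode_cnf S')" using Cons by simp
      note run = rec branch[unfolded S]
      show ?thesis unfolding step
        apply (intro runI[OF code(13)])
           apply (rule evb_rules run | (simp add: S; fail))+
        using B by (simp add: algebra_simps)
    qed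
  qed
qed

text \<open>The invariant \<open>I\<close> is abstract: it only has to bound number and size of the
  states in every round. The combinatorial bound is supplied later.\<close>

lemma run_iterate:
  assumes F: "size (encode_cnf F) \<le> X"
    and Ss: "I Ss"
    and I_step: "\<And>Ss. I Ss \<Longrightarrow> I (step F Ss [])"
    and I_size: "\<And>Ss S. I Ss \<Longrightarrow> S \<in> set Ss \<Longrightarrow> size (encode_cnf S) \<le> X"
    and I_length: "\<And>Ss. I Ss \<Longrightarrow> length Ss \<le> Q"
  shows "run prog ITERATE [encode_cnf F, encode_list enc fuel, encode_list encode_cnf Ss]
    (encode_list encode_cnf (iterate F fuel Ss)) (700 * ((X + 1) ^ 6 * (Q + 1) ^ 2) * (length fuel + 1))"
proof -
  define B where "B = (X + 1) ^ 6 * (Q + 1) ^ 2"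
  have B: "1 \<le> B" by (simp add: B_def Suc_le_eq)
  show ?thesis using Ss unfolding B_def[symmetric]
  proof (induction fuel arbitrary: Ss)
    case Nil
    show ?case using B by (intro runI[OF code(14)]) (rule evb_rules | simp)+
  next
    case (Cons a fuel)
    have "600 * ((X + 1) ^ 6 * (Q + 1)) * (length Ss + 1) \<le> 600 * ((X + 1) ^ 6 * (Q + 1)) * (Q + 1)"
      using I_length[OF Cons.prems] by (intro mult_le_mono2) simp
    also have "\<dots> = 600 * B" by (simp add: B_def power2_eq_square algebra_simps)
    finally have "600 * ((X + 1) ^ 6 * (Q + 1)) * (length Ss + 1) \<le> 600 * B" .
    note step = run_weaken[OF run_step[OF F I_size[OF Cons.prems] I_length[OF I_step[OF Cons.prems]]] this,
        simplified]
    note run = step Cons.IH[OF I_step[OF Cons.prems]]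
    show ?case unfolding iterate.simps
      apply (intro runI[OF code(14)])
         apply (rule evb_rules run | (simp; fail))+
      using B by (simp add: algebra_simps)
  qed
qed

text \<open>The seventh factor \<open>X + 1\<close> counts the rounds; the cost of layering is
  dominated.\<close>

lemma run_main:
  fixes c :: "nat list" and R :: "nat list list"
  defines "F \<equiv> layered [c] R"
  assumes X: "size (encode_cnf (c # R)) \<le> X"
    and start: "I [F]"
    and I_step: "\<And>Ss. I Ss \<Longrightarrow> I (step F Ss [])"
    and I_size: "\<And>Ss S. I Ss \<Longrightarrow> S \<in> set Ss \<Longrightarrow> size (encode_cnf S) \<le> X"
    and I_length: "\<And>Ss. I Ss \<Longrightarrow> length Ss \<le> Q"
  shows "run prog MAIN [encode_cnf (c # R)] (encode_list encode_cnf (iterate F F [F]))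
    (1200 * ((X + 1) ^ 7 * (Q + 1) ^ 2))"
proof -
  define B where "B = (X + 1) ^ 7 * (Q + 1) ^ 2"
  have B: "1 \<le> B" by (simp add: B_def Suc_le_eq)
  have "size (encode_cnf F) = size (encode_cnf (c # R))"
    unfolding F_def size_layered by simp
  then have F: "size (encode_cnf F) \<le> X" using X by simp
  have "length F + 1 \<le> X + 1" using length_le_size[of F encode_clause] F by simp
  then have "700 * ((X + 1) ^ 6 * (Q + 1) ^ 2) * (length F + 1)
      \<le> 700 * ((X + 1) ^ 6 * (Q + 1) ^ 2) * (X + 1)"
    by (rule mult_le_mono2)
  also have "\<dots> = 700 * B" unfolding B_def using power_Suc2[of "X + 1" 6] by (simp add: algebra_simps)
  finally have "700 * ((X + 1) ^ 6 * (Q + 1) ^ 2) * (length F + 1) \<le> 700 * B" .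
  note iterate = run_weaken[OF run_iterate[OF F start I_step I_size I_length] this, unfolded encode_list.simps]
  have start: "run prog START [encode_cnf F] (encode_list encode_cnf (iterate F F [F])) (720 * B)"
    apply (intro runI[OF code(2)])
       apply (rule evb_rules iterate | (simp; fail))+
    using B by simp
  have "length R + 1 \<le> X + 1" using length_le_size[of "c # R" encode_clause] X by simp
  then have "400 * (X + 1) ^ 5 * (length R + 1) \<le> 400 * (X + 1) ^ 5 * (X + 1)" by (rule mult_le_mono2)
  also have "\<dots> = 400 * ((X + 1) ^ 6 * 1)" using power_Suc2[of "X + 1" 5] by simp
  also have "\<dots> \<le> 400 * B" unfolding B_def
    by (intro mult_le_mono power_increasing) auto
  finally have "400 * (X + 1) ^ 5 * (length R + 1) \<le> 400 * B" .
  note layered = run_weaken[OF run_layered this, of "[c]", folded F_def]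
  have "run prog LAYERED [Cell (encode_clause c) Atom, encode_cnf R] (encode_cnf F) (400 * B)"
    using layered X by simp
  note run = this start
  show ?thesis unfolding B_def[symmetric]
    apply (intro runI[OF code(1)])
       apply (rule evb_rules run | (simp; fail))+
    using B by simp
qed


section \<open>Correctness of the search\<close>

lemma touches_singleton [simp]: "touches [[v]] c \<longleftrightarrow> v \<in> set c"
  by (auto simp: touches_def)

definition successors :: "nat list list \<Rightarrow> nat list list \<Rightarrow> nat list list set" where
  "successors F S = (case S of [] \<Rightarrow> {[]} | c # _ \<Rightarrow>
    (\<lambda>v. far [[v]] S) ` {v \<in> set c. near [[v]] S = near [[v]] F})"

lemma set_ins [simp]: "set (ins x xs) = insert x (set xs)"
  by (auto simp: ins_def)

lemma distinct_ins: "distinct xs \<Longrightarrow> distinct (ins x xs)"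
  by (auto simp: ins_def)

lemma set_branch:
  "set (branch F S vs acc) =
    set acc \<union> (\<lambda>v. far [[v]] S) ` {v \<in> set vs. near [[v]] S = near [[v]] F}"
  by (induction vs arbitrary: acc) auto

lemma distinct_branch: "distinct acc \<Longrightarrow> distinct (branch F S vs acc)"
  by (induction vs arbitrary: acc) (auto simp: distinct_ins)

lemma set_step: "set (step F Ss acc) = set acc \<union> (\<Union>S\<in>set Ss. successors F S)"
proof (induction Ss arbitrary: acc)
  case (Cons S Ss)
  have "set (case S of [] \<Rightarrow> ins [] acc | c # _ \<Rightarrow> branch F S c acc) = set acc \<union> successors F S"
    by (auto simp: successors_def set_branch split: list.split)
  then show ?case using Cons.IH by auto
qed simp

lemma distinct_step: "distinct acc \<Longrightarrow> distinct (step F Ss acc)"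
  by (induction Ss arbitrary: acc) (auto simp: distinct_ins distinct_branch split: list.split)

lemma iterate_invariant:
  assumes "I Ss" "\<And>Ss. I Ss \<Longrightarrow> I (step F Ss [])"
  shows "I (iterate F fuel Ss)"
  using assms(1) by (induction fuel arbitrary: Ss) (auto simp: assms(2))

section \<open>Search states as sets of uncovered clauses\<close>

definition uncovered :: "nat list list \<Rightarrow> nat set \<Rightarrow> nat list list" where
  "uncovered F T = filter (\<lambda>c. set c \<inter> T = {}) F"

lemma far_uncovered: "far [[v]] (uncovered F T) = uncovered F (insert v T)"
  by (auto simp: uncovered_def intro!: filter_cong)

text \<open>The two filters agree exactly when no clause with \<open>v\<close> has been dropped. So
  the state decides admissibility without remembering \<open>T\<close>, and states reached by
  different choices can be merged.\<close>

lemma near_uncovered: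
  "near [[v]] (uncovered F T) = near [[v]] F \<longleftrightarrow> (\<forall>c\<in>set F. v \<in> set c \<longrightarrow> set c \<inter> T = {})"
proof
  assume "near [[v]] (uncovered F T) = near [[v]] F"
  then have "set (near [[v]] (uncovered F T)) = set (near [[v]] F)" by simp
  then show "\<forall>c\<in>set F. v \<in> set c \<longrightarrow> set c \<inter> T = {}" by (auto simp: uncovered_def)
next
  assume "\<forall>c\<in>set F. v \<in> set c \<longrightarrow> set c \<inter> T = {}"
  then show "near [[v]] (uncovered F T) = near [[v]] F"
    by (auto simp: uncovered_def intro!: filter_cong)
qed

text \<open>The chosen variable lies in the first clause, so at least this clause disappears.
  Truncated subtraction covers the empty state.\<close>

lemma length_successors:
  assumes "S' \<in> successors F S"
  shows "length S' \<le> length S - 1"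
proof (cases S)
  case Nil
  then show ?thesis using assms by (simp add: successors_def)
next
  case (Cons c S0)
  then obtain v where v: "v \<in> set c" "S' = far [[v]] S" using assms by (auto simp: successors_def)
  then have "length S' < length S" using Cons by (auto simp: less_Suc_eq_le)
  then show ?thesis by simp
qed

lemma length_iterate:
  assumes "\<And>S. S \<in> set Ss \<Longrightarrow> length S \<le> n" "S \<in> set (iterate F fuel Ss)"
  shows "length S \<le> n - length fuel"
  using assms
proof (induction fuel arbitrary: Ss n)
  case (Cons a fuel)
  have "length S' \<le> n - 1" if S': "S' \<in> set (step F Ss [])" for S'
  proof -
    obtain S0 where "S0 \<in> set Ss" "S' \<in> successors F S0" using S' by (auto simp: set_step)
    then show ?thesis using Cons.prems(1)[of S0] length_successors[of S' F S0] by linarith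
  qed
  then show ?case using Cons.IH[of "step F Ss []" "n - 1"] Cons.prems(2) by simp
qed simp

definition partial_solution :: "nat list list \<Rightarrow> nat set \<Rightarrow> bool" where
  "partial_solution F T \<longleftrightarrow> (\<forall>c\<in>set F. \<forall>x\<in>set c \<inter> T. \<forall>y\<in>set c \<inter> T. x = y)"

text \<open>Admissibility of \<open>v\<close> says that clauses with \<open>v\<close> do not meet
  \<open>T\<close>, so adding \<open>v\<close> creates no second true variable in any
  clause.\<close>

lemma successors_sound:
  assumes "partial_solution F T" "S' \<in> successors F (uncovered F T)"
  shows "\<exists>T'. partial_solution F T' \<and> S' = uncovered F T'"
proof (cases "uncovered F T")
  case Nil
  then show ?thesis using assms by (auto simp: successors_def)
next
  case (Cons c S)
  then obtain v where v: "near [[v]] (uncovered F T) = near [[v]] F" "S' = far [[v]] (uncovered F T)"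
    using assms(2) unfolding Cons successors_def list.case by blast
  then have "\<forall>c\<in>set F. v \<in> set c \<longrightarrow> set c \<inter> T = {}" by (simp only: near_uncovered)
  then have "partial_solution F (insert v T)"
    using assms(1) unfolding partial_solution_def by blast
  then show ?thesis using v(2) far_uncovered by blast
qed

text \<open>Branching on the true variable that a fixed solution \<open>T\<close> has in the first
  clause keeps the search inside \<open>T\<close>.\<close>

lemma successors_complete:
  assumes T: "\<forall>c\<in>set F. \<exists>!x. x \<in> set c \<and> x \<in> T" and "T0 \<subseteq> T"
  shows "\<exists>T'\<subseteq>T. uncovered F T' \<in> successors F (uncovered F T0)"
proof (cases "uncovered F T0")
  case Nil
  then show ?thesis using assms(2) by (auto simp: successors_def)
next
  case (Cons c S)
  then have "c \<in> set (uncovered F T0)" by simp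
  then have c: "c \<in> set F" "set c \<inter> T0 = {}" by (auto simp: uncovered_def)
  then obtain v where v: "v \<in> set c" "v \<in> T" using T by blast
  \<comment> \<open>In \<open>d\<close> the variable \<open>v\<close> is the only element of
    \<open>T\<close>, and \<open>v\<close> is not in \<open>T0\<close> because \<open>c\<close> is
    still uncovered.\<close>
  have "\<forall>d\<in>set F. v \<in> set d \<longrightarrow> set d \<inter> T0 = {}" using T v c assms(2) by blast
  then have "near [[v]] (uncovered F T0) = near [[v]] F" by (simp only: near_uncovered)
  then have "far [[v]] (uncovered F T0) \<in> successors F (uncovered F T0)"
    using Cons v(1) by (auto simp: successors_def)
  then show ?thesis using far_uncovered v(2) assms(2) by (metis insert_subset)
qed

text \<open>Each round shortens every nonempty state, so after \<open>length F\<close> rounds only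
  the empty state can be left, and it occurs at most once because duplicates are merged. Soundness
  and completeness are carried through the rounds as invariants.\<close>

lemma iterate_correct:
  "iterate F F [F] = (if xsat (set ` set F) then [[]] else [])"
proof -
  let ?Ss = "iterate F F [F]"
  have F: "F = uncovered F {}" by (simp add: uncovered_def)
  have nil: "S = []" if "S \<in> set ?Ss" for S
    using length_iterate[of "[F]" "length F" S F F] that by simp
  have "distinct ?Ss" by (rule iterate_invariant) (auto simp: distinct_step)
  moreover have "set ?Ss \<subseteq> {[]}" using nil by blast
  ultimately have Ss: "?Ss = [] \<or> ?Ss = [[]]"
    by (cases ?Ss; cases "tl ?Ss") auto
  have "?Ss \<noteq> [] \<longleftrightarrow> xsat (set ` set F)"
  proof
    assume "?Ss \<noteq> []"
    then have "[] \<in> set ?Ss" using nil by (metis last_in_set)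
    moreover have "\<forall>S\<in>set ?Ss. \<exists>T. partial_solution F T \<and> S = uncovered F T"
    proof (rule iterate_invariant)
      show "\<forall>S\<in>set [F]. \<exists>T. partial_solution F T \<and> S = uncovered F T"
        using F by (auto simp: partial_solution_def)
    qed (use successors_sound in \<open>auto simp: set_step\<close>)
    ultimately obtain T where T: "partial_solution F T" "uncovered F T = []" by metis
    have "\<exists>!x. x \<in> set c \<and> x \<in> T" if c: "c \<in> set F" for c
    proof -
      obtain x where "x \<in> set c" "x \<in> T"
        using T(2) c unfolding uncovered_def filter_empty_conv by blast
      then show ?thesis using T(1) c unfolding partial_solution_def by blast
    qed
    then show "xsat (set ` set F)" unfolding xsat_def by (intro exI[of _ "\<lambda>x. x \<in> T"]) auto
  next
    assume "xsat (set ` set F)"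
    then obtain \<tau> where "\<forall>c\<in>set F. \<exists>!x. x \<in> set c \<and> \<tau> x" unfolding xsat_def by auto
    then have T: "\<forall>c\<in>set F. \<exists>!x. x \<in> set c \<and> x \<in> Collect \<tau>" by simp
    have "\<exists>T\<subseteq>Collect \<tau>. uncovered F T \<in> set ?Ss"
    proof (rule iterate_invariant)
      show "\<exists>T\<subseteq>Collect \<tau>. uncovered F T \<in> set [F]" using F by (intro exI[of _ "{}"]) simp
    next
      fix Ss assume "\<exists>T\<subseteq>Collect \<tau>. uncovered F T \<in> set Ss"
      then obtain T0 where T0: "T0 \<subseteq> Collect \<tau>" "uncovered F T0 \<in> set Ss" by blast
      then obtain T' where T': "T' \<subseteq> Collect \<tau>" "uncovered F T' \<in> successors F (uncovered F T0)"
        using successors_complete[OF T] by blast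
      then have "uncovered F T' \<in> set (step F Ss [])" using T0(2) unfolding set_step by blast
      then show "\<exists>T\<subseteq>Collect \<tau>. uncovered F T \<in> set (step F Ss [])" using T'(1) by blast
    qed
    then show "?Ss \<noteq> []" by auto
  qed
  then show ?thesis using Ss by auto
qed

lemma set_layered: "set (layered L R) = set L \<union> set R"
  by (induction L R rule: layered.induct) (auto simp: layered.simps)


section \<open>Counting the states\<close>

text \<open>The second condition says that all clauses two or more levels beyond an uncovered one
  are uncovered too. By the filter form, a state is determined by which clauses it contains.\<close>

definition frontier_state :: "(nat list \<Rightarrow> nat) \<Rightarrow> nat list list \<Rightarrow> nat list list \<Rightarrow> bool" where
  "frontier_state lev F S \<longleftrightarrow> (\<exists>P. S = filter P F) \<and>
    (\<forall>d\<in>set F - set S. \<forall>e\<in>set S. lev d \<le> lev e + 1)"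

text \<open>A newly covered clause shares \<open>v\<close> with the head \<open>h\<close>, hence
  lies at most one level above it, and by sortedness no remaining clause is below
  \<open>h\<close>.\<close>

lemma frontier_state_successors:
  assumes sorted: "sorted (map lev F)"
    and adj: "\<And>c d. c \<in> set F \<Longrightarrow> d \<in> set F \<Longrightarrow> set c \<inter> set d \<noteq> {} \<Longrightarrow> lev d \<le> lev c + 1"
    and S: "frontier_state lev F S" and S': "S' \<in> successors F S"
  shows "frontier_state lev F S'"
proof (cases S)
  case Nil
  then show ?thesis using S S' by (auto simp: successors_def)
next
  case (Cons h S0)
  then obtain v where v: "v \<in> set h" "S' = far [[v]] S"
    using S' unfolding Cons successors_def list.case by blast
  obtain P where P: "S = filter P F" using S by (auto simp: frontier_state_def)
  have "sorted (map lev S)" unfolding P using sorted by (rule sorted_filter)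
  then have h_le: "lev h \<le> lev e" if "e \<in> set S" for e using that Cons by auto
  have h: "h \<in> set F" using Cons P by (metis filter_is_subset list.set_intros(1) subsetD)
  have "lev d \<le> lev e + 1" if d: "d \<in> set F" "d \<notin> set S'" and e: "e \<in> set S'" for d e
  proof (cases "d \<in> set S")
    case True
    then have "v \<in> set d" using d v(2) by simp
    then have "lev d \<le> lev h + 1" using adj[OF h d(1)] v(1) by blast
    then show ?thesis using h_le[of e] e v(2) by simp
  next
    case False
    then show ?thesis using S d(1) e v(2) by (simp add: frontier_state_def)
  qed
  moreover have "S' = filter (\<lambda>c. P c \<and> v \<notin> set c) F" by (simp add: v(2) P)
  ultimately show ?thesis unfolding frontier_state_def by blast
qed

lemma card_frontier_states:
  assumes sorted: "sorted (map lev F)"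
    and B: "\<And>j. card {d \<in> set F. lev d = j \<or> lev d = j + 1} \<le> B"
  shows "finite {S. frontier_state lev F S}" (is ?fin)
    and "card {S. frontier_state lev F S} \<le> length F * 2 ^ B + 1" (is ?card)
proof -
  let ?layers = "\<lambda>h. {d \<in> set F. lev d = lev h \<or> lev d = lev h + 1}"
  \<comment> \<open>These are the candidates with first clause on the level of \<open>h\<close>:
    nothing below it, an arbitrary part \<open>A\<close> of the two layers, everything from two
    levels above. The empty state is added separately and accounts for the
    \<open>+ 1\<close>.\<close>
  let ?states = "\<lambda>h. (\<lambda>A. filter (\<lambda>d. d \<in> A \<or> lev h + 2 \<le> lev d) F) ` Pow (?layers h)"
  have sub: "{S. frontier_state lev F S} \<subseteq> insert [] (\<Union>h\<in>set F. ?states h)"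
  proof
    fix S assume "S \<in> {S. frontier_state lev F S}"
    then have S: "frontier_state lev F S" by simp
    then obtain P where P: "S = filter P F" by (auto simp: frontier_state_def)
    show "S \<in> insert [] (\<Union>h\<in>set F. ?states h)"
    proof (cases S)
      case (Cons h S0)
      have h: "h \<in> set F" using Cons P by (metis filter_is_subset list.set_intros(1) subsetD)
      have "sorted (map lev S)" unfolding P using sorted by (rule sorted_filter)
      then have h_le: "lev h \<le> lev e" if "e \<in> set S" for e using that Cons by auto
      define A where "A = {d \<in> set S. lev d \<le> lev h + 1}"
      have "A \<in> Pow (?layers h)"
        using h_le unfolding A_def P by (auto simp: le_Suc_eq dest: le_antisym)
      moreover have "S = filter (\<lambda>d. d \<in> A \<or> lev h + 2 \<le> lev d) F"
      proof -
        have "P d \<longleftrightarrow> d \<in> A \<or> lev h + 2 \<le> lev d" if d: "d \<in> set F" for d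
        proof -
          have dS: "d \<in> set S \<longleftrightarrow> P d" using P d by simp
          have "lev d \<le> lev h + 1" if "d \<notin> set S"
            using S d that Cons unfolding frontier_state_def by auto
          then show ?thesis unfolding A_def using dS by fastforce
        qed
        then show ?thesis unfolding P by (intro filter_cong) auto
      qed
      ultimately show ?thesis using h by blast
    qed simp
  qed
  have fin: "finite (\<Union>h\<in>set F. ?states h)" by simp
  show ?fin using finite_subset[OF sub] fin by simp
  have "card (?states h) \<le> 2 ^ B" for h
  proof -
    have "card (?states h) \<le> card (Pow (?layers h))" by (rule card_image_le) simp
    also have "\<dots> = 2 ^ card (?layers h)" by (rule card_Pow) simp
    also have "\<dots> \<le> 2 ^ B" using B by (intro power_increasing) auto
    finally show ?thesis .
  qed
  then have "(\<Sum>h\<in>set F. card (?states h)) \<le> card (set F) * 2 ^ B"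
    by (metis (no_types, lifting) sum_bounded_above mult.commute of_nat_id)
  moreover have "card (\<Union>h\<in>set F. ?states h) \<le> (\<Sum>h\<in>set F. card (?states h))"
    by (rule card_UN_le) simp
  moreover have "card (set F) * 2 ^ B \<le> length F * 2 ^ B" using card_length by simp
  ultimately have "card (\<Union>h\<in>set F. ?states h) \<le> length F * 2 ^ B" by linarith
  then have "card (insert [] (\<Union>h\<in>set F. ?states h)) \<le> length F * 2 ^ B + 1"
    using card_insert_le_m1 fin by (metis (no_types, lifting) Suc_eq_plus1 card_insert_if le_SucI Suc_le_mono)
  then show ?card using card_mono[OF _ sub] fin by fastforce
qed

text \<open>Here \<open>lev\<close> is any witness for the analysis; the program itself does not
  depend on it. There are at most \<open>X * 2 ^ B + 1\<close> states, since
  \<open>length F \<le> X\<close>.\<close>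

lemma run_main_levels:
  fixes lev :: "nat list \<Rightarrow> nat" and c :: "nat list" and R :: "nat list list"
  defines "F \<equiv> layered [c] R"
  defines "X \<equiv> size (encode_cnf (c # R))"
  assumes sorted: "sorted (map lev F)"
    and adj: "\<And>c d. c \<in> set F \<Longrightarrow> d \<in> set F \<Longrightarrow> set c \<inter> set d \<noteq> {} \<Longrightarrow> lev d \<le> lev c + 1"
    and B: "\<And>j. card {d \<in> set F. lev d = j \<or> lev d = j + 1} \<le> B"
  shows "run prog MAIN [encode_cnf (c # R)] (encode_bool (xsat (set ` set (c # R))))
    (1200 * ((X + 1) ^ 7 * (X * 2 ^ B + 2) ^ 2))"
proof -
  define I where "I Ss \<longleftrightarrow> distinct Ss \<and> (\<forall>S\<in>set Ss. frontier_state lev F S)" for Ss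
  have X: "size (encode_cnf F) = X" unfolding F_def X_def size_layered by simp
  have "frontier_state lev F F" unfolding frontier_state_def by (auto intro: exI[of _ "\<lambda>_. True"])
  then have start: "I [F]" by (simp add: I_def)
  have I_step: "I (step F Ss [])" if "I Ss" for Ss
    using that frontier_state_successors[OF sorted adj] distinct_step[of "[]"]
    unfolding I_def set_step by fastforce
  have I_size: "size (encode_cnf S) \<le> X" if "I Ss" "S \<in> set Ss" for Ss S
  proof -
    obtain P where "S = filter P F" using \<open>I Ss\<close> \<open>S \<in> set Ss\<close> by (auto simp: I_def frontier_state_def)
    then show ?thesis using size_filter_le[of encode_clause P F] X by simp
  qed
  have I_length: "length Ss \<le> X * 2 ^ B + 1" if "I Ss" for Ss
  proof -
    have "length Ss = card (set Ss)" using that by (simp add: I_def distinct_card)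
    also have "\<dots> \<le> card {S. frontier_state lev F S}"
      using that card_frontier_states(1)[OF sorted B] by (intro card_mono) (auto simp: I_def)
    also have "\<dots> \<le> length F * 2 ^ B + 1" using card_frontier_states(2)[OF sorted B] .
    also have "\<dots> \<le> X * 2 ^ B + 1" using length_le_size[of F encode_clause] X by simp
    finally show ?thesis .
  qed
  have "run prog MAIN [encode_cnf (c # R)] (encode_list encode_cnf (iterate F F [F]))
    (1200 * ((X + 1) ^ 7 * (X * 2 ^ B + 1 + 1) ^ 2))"
    using run_main[of c R X I, folded F_def, OF _ start I_step I_size I_length] by (simp add: X_def)
  moreover have "encode_list encode_cnf (iterate F F [F]) = encode_bool (xsat (set ` set (c # R)))"
  proof -
    have "set F = set (c # R)" unfolding F_def set_layered by simp
    then show ?thesis unfolding iterate_correct by simp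
  qed
  ultimately show ?thesis by simp
qed

section \<open>Computed layers agree with levels\<close>

text \<open>If \<open>L\<close> is exactly level \<open>i\<close>, a clause on a higher level
  touches \<open>L\<close> iff it is on level \<open>i + 1\<close>: \<open>adj\<close> gives one
  direction and \<open>pred\<close> the other. So \<open>near L R\<close> is the next level.\<close>

lemma sorted_layered:
  fixes lev :: "nat list \<Rightarrow> nat"
  assumes adj: "\<And>c d. c \<in> V \<Longrightarrow> d \<in> V \<Longrightarrow> set c \<inter> set d \<noteq> {} \<Longrightarrow> lev d \<le> lev c + 1"
    and pred: "\<And>d i. d \<in> V \<Longrightarrow> lev d = Suc i \<Longrightarrow> \<exists>c\<in>V. lev c = i \<and> set c \<inter> set d \<noteq> {}"
    and "set L = {d \<in> V. lev d = i}" "set R = {d \<in> V. i < lev d}"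
  shows "sorted (map lev (layered L R))"
  using assms(3,4)
proof (induction L R arbitrary: i rule: layered.induct)
  case (1 L R)
  have touches: "touches L d \<longleftrightarrow> lev d = i + 1" if d: "d \<in> V" "i < lev d" for d
  proof
    assume "touches L d"
    then obtain c where c: "c \<in> set L" "set c \<inter> set d \<noteq> {}" unfolding touches_def by blast
    then have "c \<in> V" "lev c = i" using 1(2) by auto
    then have "lev d \<le> i + 1" using adj[of c d] d c(2) by simp
    then show "lev d = i + 1" using d by simp
  next
    assume "lev d = i + 1"
    then obtain c where "c \<in> V" "lev c = i" "set c \<inter> set d \<noteq> {}" using pred[of d i] d by fastforce
    then show "touches L d" using 1(2) unfolding touches_def by blast
  qed
  have near: "set (near L R) = {d \<in> V. lev d = i + 1}"
    using touches unfolding set_filter 1(3) by auto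
  have far: "set (far L R) = {d \<in> V. i + 1 < lev d}"
    using touches unfolding set_filter 1(3) by (auto simp: Suc_lessI)
  have L: "sorted (map lev L)" using 1(2) proof -
    have "map lev L = map (\<lambda>_. i) L" using 1(2) by simp
    then show ?thesis by (simp add: map_replicate_const)
  qed
  show ?case
  proof (cases "near L R = []")
    case True
    \<comment> \<open>Following \<open>pred\<close> downwards shows that no level below an occupied
      one is empty. Hence an empty level \<open>i + 1\<close> leaves nothing in
      \<open>R\<close>.\<close>
    have "\<exists>c\<in>V. lev c = j" if "d \<in> V" "j \<le> lev d" for j d
      using that(2,1)
    proof (induction "lev d - j" arbitrary: d)
      case (Suc n)
      have "lev d = Suc (lev d - 1)" using Suc.hyps(2) by simp
      then obtain c where "c \<in> V" "lev c = lev d - 1" using pred Suc.prems(2) by blast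
      then show ?case using Suc.hyps(1)[of c] Suc.hyps(2) by simp
    qed auto
    moreover have "\<not> (\<exists>c\<in>V. lev c = i + 1)" using near unfolding True by auto
    ultimately have "\<not> i + 1 \<le> lev d" if "d \<in> V" for d using that by blast
    then have "set R = {}" unfolding 1(3) by (auto simp: Suc_le_eq)
    then have "R = []" by simp
    then show ?thesis using L True by (simp add: layered.simps)
  next
    case False
    have "sorted (map lev (layered (near L R) (far L R)))" using 1(1)[OF False near far] .
    then have "sorted (map lev (L @ layered (near L R) (far L R)))"
      using L near far 1(2) by (auto simp: sorted_append set_layered)
    then show ?thesis using False by (simp add: layered.simps[of L R])
  qed
qed


section \<open>Breadth-first levels in a graph with a linear structure\<close>

text \<open>Breadth-first distance from \<open>a\<close>. For an unreachable \<open>v\<close> the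
  value is unspecified, so reachability is assumed where a walk of this length is needed.\<close>

definition level :: "('a \<times> 'a) set \<Rightarrow> 'a \<Rightarrow> 'a \<Rightarrow> nat" where
  "level E a v = (LEAST n. (a, v) \<in> E ^^ n)"

lemma level_le: "(a, v) \<in> E ^^ n \<Longrightarrow> level E a v \<le> n"
  unfolding level_def by (rule Least_le)

lemma level_relpow: "(a, v) \<in> E\<^sup>* \<Longrightarrow> (a, v) \<in> E ^^ level E a v"
  unfolding level_def by (metis LeastI rtrancl_power)

lemma level_relpow_le:
  assumes "(a, u) \<in> E\<^sup>*" "(u, v) \<in> E ^^ n"
  shows "level E a v \<le> level E a u + n"
proof (rule level_le)
  show "(a, v) \<in> E ^^ (level E a u + n)"
    using level_relpow[OF assms(1)] assms(2) by (auto simp: relpow_add)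
qed

lemma level_edge:
  assumes "(a, u) \<in> E\<^sup>*" "(u, v) \<in> E"
  shows "level E a v \<le> level E a u + 1"
  using level_relpow_le[OF assms(1), of v 1] assms(2) by simp

lemma level_eq_0: "(a, v) \<in> E\<^sup>* \<Longrightarrow> level E a v = 0 \<longleftrightarrow> v = a"
  using level_relpow[of a v E] level_le[of a a 0 E] by auto

lemma level_pred:
  assumes "(a, v) \<in> E\<^sup>*" "level E a v = Suc i"
  obtains u where "(a, u) \<in> E\<^sup>*" "(u, v) \<in> E" "level E a u = i"
proof -
  have "(a, v) \<in> E ^^ Suc i" using level_relpow[OF assms(1)] assms(2) by simp
  then obtain u where u: "(a, u) \<in> E ^^ i" "(u, v) \<in> E" by (rule relpow_Suc_E)
  have au: "(a, u) \<in> E\<^sup>*" using u(1) relpow_imp_rtrancl by blast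
  have "level E a u = i" using level_le[OF u(1)] level_edge[OF au u(2)] assms(2) by simp
  then show ?thesis using that au u(2) by blast
qed

text \<open>A discrete intermediate value argument: \<open>w\<close> comes right after the last
  visit below \<open>r\<close> (or is the start), and a step changes the link by at most 2, which
  also limits the climb from \<open>w\<close> to \<open>v\<close>.\<close>

lemma crossing:
  fixes link :: "'a \<Rightarrow> int"
  assumes "\<And>u v. (u, v) \<in> E \<Longrightarrow> \<bar>link u - link v\<bar> \<le> 2"
    and "(a, v) \<in> E ^^ n" "link a \<le> r" "r \<le> link v"
  shows "\<exists>w i. i \<le> n \<and> (a, w) \<in> E ^^ i \<and> r \<le> link w \<and> link w \<le> r + 2
    \<and> link v \<le> link w + 2 * int (n - i)"
  using assms(2,4)
proof (induction n arbitrary: v)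
  case 0
  then show ?case using assms(3) by auto
next
  case (Suc n)
  from Suc.prems(1) obtain u where u: "(a, u) \<in> E ^^ n" "(u, v) \<in> E" by (rule relpow_Suc_E)
  have uv: "\<bar>link u - link v\<bar> \<le> 2" using assms(1) u(2) .
  show ?case
  proof (cases "r \<le> link u")
    case True
    then obtain w i where w: "i \<le> n" "(a, w) \<in> E ^^ i" "r \<le> link w" "link w \<le> r + 2"
      "link u \<le> link w + 2 * int (n - i)"
      using Suc.IH[OF u(1)] by blast
    then show ?thesis using uv by (intro exI[of _ w] exI[of _ i]) auto
  next
    case False
    then show ?thesis using Suc.prems uv by (intro exI[of _ v] exI[of _ "Suc n"]) auto
  qed
qed

text \<open>A shortest walk from \<open>a\<close> to \<open>v\<close> passes some \<open>w\<close>
  near the link of \<open>u\<close> at time \<open>i\<close>. Since \<open>u\<close> is within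
  \<open>D\<close> steps of \<open>w\<close>, \<open>j \<le> i + D\<close>, so at most
  \<open>D + 1\<close> steps remain after \<open>w\<close>. They gain at most
  \<open>2 * (D + 1)\<close> links, and \<open>w\<close> is at most 2 above
  \<open>u\<close>.\<close>

lemma level_window:
  fixes link :: "'a \<Rightarrow> int"
  assumes edge: "\<And>u v. (u, v) \<in> E \<Longrightarrow> \<bar>link u - link v\<bar> \<le> 2"
    and close: "\<And>u v. (a, u) \<in> E\<^sup>* \<Longrightarrow> (a, v) \<in> E\<^sup>* \<Longrightarrow> \<bar>link u - link v\<bar> \<le> 2 \<Longrightarrow> \<exists>n\<le>D. (u, v) \<in> E ^^ n"
    and u: "(a, u) \<in> E\<^sup>*" "j \<le> level E a u" and v: "(a, v) \<in> E\<^sup>*" "level E a v \<le> j + 1"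
    and le: "link a \<le> link u" "link u \<le> link v"
  shows "link v \<le> link u + int (2 * D + 4)"
proof -
  obtain w i where w: "i \<le> level E a v" "(a, w) \<in> E ^^ i" "link u \<le> link w" "link w \<le> link u + 2"
    "link v \<le> link w + 2 * int (level E a v - i)"
    using crossing[OF edge level_relpow[OF v(1)] le] by blast
  have aw: "(a, w) \<in> E\<^sup>*" using w(2) relpow_imp_rtrancl by blast
  obtain n where "n \<le> D" "(w, u) \<in> E ^^ n" using close[OF aw u(1)] w by auto
  then have "level E a u \<le> level E a w + D" using level_relpow_le[OF aw] by force
  also have "\<dots> \<le> i + D" using level_le[OF w(2)] by simp
  finally have "level E a v - i \<le> D + 1" using u(2) v(2) by simp
  then show ?thesis using w by simp
qed

text \<open>Measured from a clause with the smallest link, all others fall into a window of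
  \<open>2 * D + 5\<close> links. Staying on one side of \<open>a\<close> ensures that the walk to
  the farther clause crosses the link of the nearer one.\<close>

lemma card_half_level:
  fixes link :: "'a \<Rightarrow> int"
  assumes edge: "\<And>u v. (u, v) \<in> E \<Longrightarrow> \<bar>link u - link v\<bar> \<le> 2"
    and close: "\<And>u v. (a, u) \<in> E\<^sup>* \<Longrightarrow> (a, v) \<in> E\<^sup>* \<Longrightarrow> \<bar>link u - link v\<bar> \<le> 2 \<Longrightarrow> \<exists>n\<le>D. (u, v) \<in> E ^^ n"
    and fin: "finite V" and reach: "\<And>v. v \<in> V \<Longrightarrow> (a, v) \<in> E\<^sup>*"
    and m: "\<And>r. card {v \<in> V. link v = r} \<le> m"
  shows "card {v \<in> V. (level E a v = j \<or> level E a v = j + 1) \<and> link a \<le> link v} \<le> (2 * D + 5) * m"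
proof -
  define W where "W = {v \<in> V. (level E a v = j \<or> level E a v = j + 1) \<and> link a \<le> link v}"
  have finW: "finite W" using fin by (simp add: W_def)
  show ?thesis
  proof (cases "W = {}")
    case True
    then have "card W = 0" by simp
    then show ?thesis unfolding W_def by linarith
  next
    case False
    obtain u where u: "u \<in> W" and min: "\<And>v. v \<in> W \<Longrightarrow> link u \<le> link v"
      using ex_min_if_finite[of "link ` W"] finW False by (force simp: not_less)
    have "link v \<le> link u + int (2 * D + 4)" if v: "v \<in> W" for v
      using u v min[OF v] reach
      by (intro level_window[OF edge close, where j = j]) (auto simp: W_def)
    then have "W \<subseteq> (\<Union>r\<in>{link u..link u + int (2 * D + 4)}. {v \<in> V. link v = r})"
      using min by (auto simp: W_def)
    then have "card W \<le> card (\<Union>r\<in>{link u..link u + int (2 * D + 4)}. {v \<in> V. link v = r})"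
      using fin by (intro card_mono) auto
    also have "\<dots> \<le> (\<Sum>r\<in>{link u..link u + int (2 * D + 4)}. card {v \<in> V. link v = r})"
      by (rule card_UN_le) simp
    also have "\<dots> \<le> (\<Sum>r\<in>{link u..link u + int (2 * D + 4)}. m)" using m by (intro sum_mono)
    also have "\<dots> = (2 * D + 5) * m" by (simp add: nat_add_distrib nat_mult_distrib)
    finally show ?thesis by (simp add: W_def)
  qed
qed

lemma card_two_levels:
  fixes link :: "'a \<Rightarrow> int"
  assumes edge: "\<And>u v. (u, v) \<in> E \<Longrightarrow> \<bar>link u - link v\<bar> \<le> 2"
    and close: "\<And>u v. (a, u) \<in> E\<^sup>* \<Longrightarrow> (a, v) \<in> E\<^sup>* \<Longrightarrow> \<bar>link u - link v\<bar> \<le> 2 \<Longrightarrow> \<exists>n\<le>D. (u, v) \<in> E ^^ n"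
    and fin: "finite V" and reach: "\<And>v. v \<in> V \<Longrightarrow> (a, v) \<in> E\<^sup>*"
    and m: "\<And>r. card {v \<in> V. link v = r} \<le> m"
  shows "card {v \<in> V. level E a v = j \<or> level E a v = j + 1} \<le> 2 * ((2 * D + 5) * m)"
proof -
  let ?half = "\<lambda>link :: 'a \<Rightarrow> int. {v \<in> V. (level E a v = j \<or> level E a v = j + 1) \<and> link a \<le> link v}"
  have "card (?half link) \<le> (2 * D + 5) * m"
    by (rule card_half_level[OF edge close fin reach m])
  \<comment> \<open>The other side of \<open>a\<close> follows by reflecting the link numbers; this
    is why links are integers.\<close>
  moreover have "card (?half (\<lambda>v. - link v)) \<le> (2 * D + 5) * m"
  proof (rule card_half_level[OF _ _ fin reach])
    show "card {v \<in> V. - link v = r} \<le> m" for r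
    proof -
      have "{v \<in> V. - link v = r} = {v \<in> V. link v = - r}" by auto
      then show ?thesis using m[of "- r"] by simp
    qed
  qed (use edge close in \<open>auto simp: abs_minus_commute\<close>)
  moreover have "{v \<in> V. level E a v = j \<or> level E a v = j + 1} = ?half link \<union> ?half (\<lambda>v. - link v)"
    by auto
  then have "card {v \<in> V. level E a v = j \<or> level E a v = j + 1}
      \<le> card (?half link) + card (?half (\<lambda>v. - link v))"
    using card_Un_le[of "?half link" "?half (\<lambda>v. - link v)"] by simp
  ultimately show ?thesis by linarith
qed


section \<open>Exact linear regular uniform formulas\<close>

locale generator =
  fixes G :: "'a formula" and l k :: nat
  assumes cnf: "monotone_cnf G" and linear: "exact_linear G"
    and regular: "regular l G" and uniform: "uniform k G"
begin

lemma finite_G: "finite G" and G_nonempty: "G \<noteq> {}"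
  using cnf by (auto simp: monotone_cnf_def)

lemma clause: "C \<in> G \<Longrightarrow> finite C" "C \<in> G \<Longrightarrow> C \<noteq> {}" "C \<in> G \<Longrightarrow> card C = k"
  using cnf uniform by (auto simp: monotone_cnf_def uniform_def)

lemma finite_vars: "finite (vars G)"
  using finite_G clause(1) by (auto simp: vars_def)

lemma in_vars: "C \<in> G \<Longrightarrow> t \<in> C \<Longrightarrow> t \<in> vars G"
  by (auto simp: vars_def)

lemma card_clauses_containing: "t \<in> vars G \<Longrightarrow> card {C \<in> G. t \<in> C} = l"
  using regular by (auto simp: regular_def)

lemma intersect: "C \<in> G \<Longrightarrow> D \<in> G \<Longrightarrow> C \<inter> D \<noteq> {}"
  using linear clause(2) unfolding exact_linear_def by (metis card.empty inf.idem zero_neq_one)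

lemma card_intersect: "C \<in> G \<Longrightarrow> D \<in> G \<Longrightarrow> C \<noteq> D \<Longrightarrow> card (C \<inter> D) = 1"
  using linear by (auto simp: exact_linear_def)

lemma k_pos: "k \<ge> 1"
proof -
  obtain C where "C \<in> G" using G_nonempty by blast
  then show ?thesis using clause[of C] by (metis One_nat_def Suc_leI card_gt_0_iff)
qed

lemma double_count: "k * card G = l * card (vars G)"
proof -
  have "l * card (vars G) = (\<Sum>t\<in>vars G. card {C \<in> G. t \<in> C})"
    using card_clauses_containing by simp
  also have "\<dots> = (\<Sum>t\<in>vars G. \<Sum>C\<in>G. if t \<in> C then 1 else 0)"
    using sum.inter_filter[OF finite_G, of "\<lambda>_. 1::nat"] by simp
  also have "\<dots> = (\<Sum>C\<in>G. \<Sum>t\<in>vars G. if t \<in> C then 1 else 0)" by (rule sum.swap)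
  also have "\<dots> = (\<Sum>C\<in>G. card {t \<in> vars G. t \<in> C})"
    using sum.inter_filter[OF finite_vars, of "\<lambda>_. 1::nat"] by simp
  also have "\<dots> = (\<Sum>C\<in>G. k)"
  proof (rule sum.cong[OF refl])
    fix C assume "C \<in> G"
    then have "{t \<in> vars G. t \<in> C} = C" by (auto simp: vars_def)
    then show "card {t \<in> vars G. t \<in> C} = k" using clause \<open>C \<in> G\<close> by simp
  qed
  finally show ?thesis by (simp add: mult.commute)
qed

lemma card_G_le: "card G \<le> k * l"
proof -
  obtain C where C: "C \<in> G" using G_nonempty by blast
  have "G \<subseteq> (\<Union>t\<in>C. {D \<in> G. t \<in> D})" using intersect[OF C] by blast
  then have "card G \<le> card (\<Union>t\<in>C. {D \<in> G. t \<in> D})"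
    using finite_G clause(1)[OF C] by (intro card_mono) auto
  also have "\<dots> \<le> (\<Sum>t\<in>C. card {D \<in> G. t \<in> D})" using clause(1)[OF C] by (rule card_UN_le)
  also have "\<dots> = (\<Sum>t\<in>C. l)" using card_clauses_containing in_vars[OF C] by (intro sum.cong) auto
  also have "\<dots> = k * l" using clause(3)[OF C] by simp
  finally show ?thesis .
qed

lemma other_clause:
  assumes "l \<ge> 2" "C \<in> G" "t \<in> C"
  obtains D where "D \<in> G" "t \<in> D" "D \<noteq> C"
proof -
  have "card {D \<in> G. t \<in> D} = l" using card_clauses_containing in_vars assms by blast
  then have "\<not> {D \<in> G. t \<in> D} \<subseteq> {C}"
    using assms(1) card_mono[of "{C}" "{D \<in> G. t \<in> D}"] by auto
  then show ?thesis using that by blast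
qed

end


section \<open>Clauses of entangled links\<close>

text \<open>The range of \<open>r\<close> is part of the definition because \<open>pos\<close> is
  arbitrary outside it. In particular \<open>r - 1\<close> is harmless for the first link.\<close>

definition moved :: "nat \<Rightarrow> (nat \<Rightarrow> 'a clause \<times> 'a) \<Rightarrow> nat \<Rightarrow> 'a clause \<Rightarrow> 'a \<Rightarrow> bool" where
  "moved q pos r C t \<longleftrightarrow> 1 \<le> r \<and> r \<le> q \<and> pos r = (C, t)"

text \<open>A closed form for the iterated updates: a clause holds its own copy of \<open>t\<close>
  unless a swap on either side removed it, plus copies received from the two neighbouring links.
  Writing \<open>r = x + 1\<close> avoids truncated subtraction.\<close>

lemma mem_entangle_first:
  "(x, t) \<in> entangle_first q pos (r, C) \<longleftrightarrow>
    x = r \<and> t \<in> C \<and> \<not> moved q pos r C t \<and> \<not> moved q pos (r - 1) C t \<or>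
    x = r + 1 \<and> moved q pos r C t \<or> r = x + 1 \<and> moved q pos x C t"
proof (induction q arbitrary: x t r C)
  case 0
  show ?case by (auto simp: moved_def linear_chain_def)
next
  case (Suc q)
  obtain C0 s where pos: "pos (Suc q) = (C0, s)" by fastforce
  have moved: "moved (Suc q) pos i C t \<longleftrightarrow> moved q pos i C t \<or> i = Suc q \<and> C0 = C \<and> s = t" for i C t
    using pos by (auto simp: moved_def le_Suc_eq)
  have not_moved: "\<not> moved q pos (Suc q) C t" "\<not> moved q pos (Suc (Suc q)) C t" for C t
    by (auto simp: moved_def)
  have step: "entangle_first (Suc q) pos (r, C) =
      (if C = C0 \<and> r = Suc q then insert (Suc (Suc q), s) (entangle_first q pos (r, C) - {(Suc q, s)})
       else if C = C0 \<and> r = Suc (Suc q) then insert (Suc q, s) (entangle_first q pos (r, C) - {(Suc (Suc q), s)})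
       else entangle_first q pos (r, C))" for r C
    by (simp add: pos entangle_def)
  show ?case unfolding step moved using not_moved
    by (auto simp: Suc.IH)
qed

locale entangled = generator +
  fixes q :: nat and pos :: "nat \<Rightarrow> 'a clause \<times> 'a"
  assumes pos: "\<And>r. r \<in> {1..q} \<Longrightarrow> fst (pos r) \<in> G \<and> snd (pos r) \<in> fst (pos r)"
    and inj_pos: "inj_on pos {1..q}"
begin

abbreviation index :: "(nat \<times> 'a clause) set" where
  "index \<equiv> {1..Suc q} \<times> G"

abbreviation clause_at :: "nat \<times> 'a clause \<Rightarrow> (nat \<times> 'a) clause" where
  "clause_at \<equiv> entangle_first q pos"

abbreviation moved_at :: "nat \<Rightarrow> 'a clause \<Rightarrow> 'a \<Rightarrow> bool" where
  "moved_at \<equiv> moved q pos"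

definition adjacent :: "((nat \<times> 'a clause) \<times> (nat \<times> 'a clause)) set" where
  "adjacent = {(i, j). i \<in> index \<and> j \<in> index \<and> clause_at i \<inter> clause_at j \<noteq> {}}"

lemma moved_at_mem: "moved_at r C t \<Longrightarrow> C \<in> G \<and> t \<in> C \<and> 1 \<le> r \<and> r \<le> q"
  using pos[of r] by (auto simp: moved_def)

lemma moved_at_unique: "moved_at r C t \<Longrightarrow> moved_at r' C t \<Longrightarrow> r = r'"
  unfolding moved_def by (rule inj_onD[OF inj_pos]) auto

lemma clause_at_subset:
  assumes "i \<in> index"
  shows "clause_at i \<subseteq> {1..Suc q} \<times> vars G"
proof -
  obtain r C where i: "i = (r, C)" by fastforce
  have "x \<in> {1..Suc q} \<and> t \<in> vars G" if mem: "(x, t) \<in> clause_at (r, C)" for x t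
  proof -
    have C: "r \<in> {1..Suc q}" "C \<in> G" using assms i by auto
    consider "x = r" "t \<in> C" | "x = r + 1" "moved_at r C t" | "moved_at x C t"
      using mem unfolding mem_entangle_first by blast
    then show ?thesis
    proof cases
      case 1
      then show ?thesis using C in_vars by blast
    next
      case 2
      then have "t \<in> C" "1 \<le> r" "r \<le> q" using moved_at_mem by blast+
      then show ?thesis using C in_vars 2 by auto
    next
      case 3
      then have "t \<in> C" "1 \<le> x" "x \<le> q" using moved_at_mem by blast+
      then show ?thesis using C in_vars by auto
    qed
  qed
  then show ?thesis unfolding i by (intro subrelI) (simp add: mem_Times_iff)
qed

lemma Union_clause_at_subset: "\<Union>(clause_at ` index) \<subseteq> {1..Suc q} \<times> vars G"
  by (rule UN_least) (rule clause_at_subset)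

lemma clause_at_nonempty:
  assumes "i \<in> index"
  shows "clause_at i \<noteq> {}"
proof -
  obtain r C where i: "i = (r, C)" by fastforce
  then obtain t where t: "t \<in> C" using clause(2)[of C] assms by blast
  consider "moved_at r C t" | "moved_at (r - 1) C t" | "\<not> moved_at r C t" "\<not> moved_at (r - 1) C t"
    by blast
  then have "\<exists>x. (x, t) \<in> clause_at (r, C)"
  proof cases
    case 2
    then have "r = r - 1 + 1" using moved_at_mem by fastforce
    then show ?thesis using 2 unfolding mem_entangle_first by blast
  qed (use t in \<open>auto simp: mem_entangle_first\<close>)
  then show ?thesis unfolding i by blast
qed

lemma sym_adjacent: "sym adjacent"
  by (auto simp: adjacent_def sym_def)

lemma adjacent_relpow_commute: "(i, j) \<in> adjacent ^^ n \<Longrightarrow> (j, i) \<in> adjacent ^^ n"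
proof (induction n arbitrary: j)
  case (Suc n)
  then obtain j' where "(i, j') \<in> adjacent ^^ n" "(j', j) \<in> adjacent" by auto
  then show ?case using Suc.IH sym_adjacent by (meson relpow_Suc_I2 symE)
qed simp

lemma adjacent_index: "(i, j) \<in> adjacent \<Longrightarrow> i \<in> index \<and> j \<in> index"
  by (simp add: adjacent_def)

lemma adjacentI: "i \<in> index \<Longrightarrow> j \<in> index \<Longrightarrow> y \<in> clause_at i \<Longrightarrow> y \<in> clause_at j \<Longrightarrow> (i, j) \<in> adjacent"
  by (auto simp: adjacent_def)

text \<open>A clause of link \<open>r\<close> contains only copies from links \<open>r - 1\<close>
  to \<open>r + 1\<close>, so a common variable puts two clauses at distance at most 2.\<close>

lemma adjacent_fst:
  assumes "(i, j) \<in> adjacent"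
  shows "\<bar>int (fst i) - int (fst j)\<bar> \<le> 2"
proof -
  obtain x t where "(x, t) \<in> clause_at i" "(x, t) \<in> clause_at j" using assms by (auto simp: adjacent_def)
  then show ?thesis by (cases i; cases j) (auto simp: mem_entangle_first)
qed

text \<open>A swap exchanges copies instead of sharing them, and by distinctness of the positions no
  \<open>t\<close> in \<open>C\<close> is swapped twice.\<close>

lemma disjoint_copies:
  assumes "y \<in> clause_at (r, C)" "y \<in> clause_at (r', C)"
  shows "r = r'"
proof -
  obtain x t where y: "y = (x, t)" by fastforce
  show ?thesis using assms unfolding y mem_entangle_first
    by (auto dest: moved_at_unique)
qed

lemma adjacent_unmoved:
  assumes "r \<in> {1..Suc q}" "C \<in> G" "D \<in> G"
    and "\<And>t. \<not> moved_at r C t" "\<And>t. \<not> moved_at (r - 1) C t"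
    and "\<And>t. \<not> moved_at r D t" "\<And>t. \<not> moved_at (r - 1) D t"
  shows "((r, C), (r, D)) \<in> adjacent"
proof -
  obtain t where "t \<in> C" "t \<in> D" using intersect assms(2,3) by blast
  then show ?thesis using assms
    by (intro adjacentI[where y = "(r, t)"]) (auto simp: mem_entangle_first)
qed

lemma adjacent_to_unmoved:
  assumes k: "k \<ge> 5" and l: "l \<ge> 2" and r: "r \<in> {1..Suc q}" and C: "C \<in> G"
  obtains D where "D \<in> G" "((r, C), (r, D)) \<in> adjacent"
    "\<And>t. \<not> moved_at r D t" "\<And>t. \<not> moved_at (r - 1) D t"
proof -
  \<comment> \<open>\<open>X i\<close> collects what swap \<open>i\<close> can spoil in
    \<open>C\<close>: the swapped variable and the single variable that \<open>C\<close> shares with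
    the swapped clause. The swaps \<open>r\<close> and \<open>r - 1\<close> spoil at most four, so
    \<open>k \<ge> 5\<close> leaves some \<open>t\<close>. Any second clause through
    \<open>t\<close> is then untouched by both swaps.\<close>
  define X where "X i = insert (snd (pos i))
    (if fst (pos i) \<in> G \<and> C \<noteq> fst (pos i) then C \<inter> fst (pos i) else {})" for i
  have X: "card (X i) \<le> 2" for i
  proof -
    have "card (if fst (pos i) \<in> G \<and> C \<noteq> fst (pos i) then C \<inter> fst (pos i) else {}) \<le> 1"
      using card_intersect[OF C, of "fst (pos i)"]
      by (cases "fst (pos i) \<in> G \<and> C \<noteq> fst (pos i)") auto
    then show ?thesis unfolding X_def
      by (metis card_insert_le_m1 zero_less_numeral one_add_one add_diff_cancel_left')
  qed
  have "finite (X i)" for i using clause(1)[OF C] by (simp add: X_def)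
  then have fin: "finite (X r \<union> X (r - 1))" by simp
  have "card (X r \<union> X (r - 1)) \<le> 4" using card_Un_le[of "X r" "X (r - 1)"] X[of r] X[of "r - 1"] by linarith
  then have "\<not> C \<subseteq> X r \<union> X (r - 1)" using card_mono[OF fin, of C] clause(3)[OF C] k by linarith
  then obtain t where t: "t \<in> C" "t \<notin> X r" "t \<notin> X (r - 1)" by blast
  obtain D where D: "D \<in> G" "t \<in> D" "D \<noteq> C" using other_clause[OF l C t(1)] .
  have D_unmoved: "\<not> moved_at i D s" if "t \<notin> X i" for i s
    using that D t(1) by (auto simp: X_def moved_def split: if_splits)
  have C_unmoved: "\<not> moved_at i C t" if "t \<notin> X i" for i
    using that by (auto simp: X_def moved_def)
  have "((r, C), (r, D)) \<in> adjacent"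
    using t D r C C_unmoved D_unmoved
    by (intro adjacentI[where y = "(r, t)"]) (auto simp: mem_entangle_first)
  then show ?thesis using that D(1) D_unmoved t(2,3) by blast
qed

text \<open>Both ends step to a clause untouched by swaps, and two such clauses are adjacent through
  their common variable in \<open>G\<close>.\<close>

lemma walk_in_link:
  assumes "k \<ge> 5" "l \<ge> 2" "r \<in> {1..Suc q}" "C \<in> G" "D \<in> G"
  shows "((r, C), (r, D)) \<in> adjacent ^^ 3"
proof -
  obtain C' where C': "C' \<in> G" "((r, C), (r, C')) \<in> adjacent"
    "\<And>t. \<not> moved_at r C' t" "\<And>t. \<not> moved_at (r - 1) C' t"
    using adjacent_to_unmoved[OF assms(1-4)] by blast
  obtain D' where D': "D' \<in> G" "((r, D), (r, D')) \<in> adjacent"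
    "\<And>t. \<not> moved_at r D' t" "\<And>t. \<not> moved_at (r - 1) D' t"
    using adjacent_to_unmoved[OF assms(1-3,5)] by blast
  have "((r, C'), (r, D')) \<in> adjacent" using adjacent_unmoved assms(3) C' D' by blast
  moreover have "((r, D'), (r, D)) \<in> adjacent" using D'(2) sym_adjacent by (meson symE)
  ultimately have "((r, C), (r, D)) \<in> adjacent O adjacent O adjacent" using C'(2) by blast
  then show ?thesis by (simp add: numeral_3_eq_3 O_assoc)
qed

text \<open>The positions being distinct, the other end of at least one of the two swapped variables
  stays in its own link.\<close>

lemma adjacent_links:
  assumes l: "l \<ge> 2" and r: "r \<in> {1..q}"
  obtains C D where "C \<in> G" "D \<in> G" "((r, C), (Suc r, D)) \<in> adjacent"
proof -
  obtain C s where Cs: "pos r = (C, s)" by fastforce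
  then have C: "C \<in> G" "s \<in> C" using pos[OF r] by auto
  have moved: "moved_at r C s" using Cs r by (simp add: moved_def)
  obtain D where D: "D \<in> G" "s \<in> D" "D \<noteq> C" using other_clause[OF l C] .
  have D_unmoved: "\<not> moved_at r D s" using Cs D(3) by (auto simp: moved_def)
  show ?thesis
  proof (cases "moved_at (r - 1) D s")
    case False
    have "((r, D), (Suc r, C)) \<in> adjacent"
      using False moved D_unmoved C D r
      by (intro adjacentI[where y = "(r, s)"]) (auto simp: mem_entangle_first)
    then show ?thesis using that C D by blast
  next
    case True
    then have "\<not> moved_at (Suc r) D s" using moved_at_unique[of "r - 1" D s "Suc r"] by auto
    then have "((r, C), (Suc r, D)) \<in> adjacent"
      using moved D_unmoved C D r
      by (intro adjacentI[where y = "(Suc r, s)"]) (auto simp: mem_entangle_first)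
    then show ?thesis using that C D by blast
  qed
qed

lemma walk_next_link:
  assumes "k \<ge> 5" "l \<ge> 2" "r \<in> {1..q}" "C \<in> G" "D \<in> G"
  shows "((r, C), (Suc r, D)) \<in> adjacent ^^ 7"
proof -
  obtain C' D' where CD: "C' \<in> G" "D' \<in> G" "((r, C'), (Suc r, D')) \<in> adjacent ^^ 1"
    using adjacent_links[OF assms(2,3)] by auto
  have "((r, C), (r, C')) \<in> adjacent ^^ 3" "((Suc r, D'), (Suc r, D)) \<in> adjacent ^^ 3"
    using assms CD by (auto intro!: walk_in_link)
  then have "((r, C), (Suc r, D)) \<in> adjacent ^^ (3 + 1 + 3)"
    using CD(3) unfolding relpow_add by blast
  then show ?thesis by simp
qed

text \<open>The bound 14 is two passages to a next link, each of length
  \<open>3 + 1 + 3\<close>.\<close>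

lemma short_walk:
  assumes k: "k \<ge> 5" and l: "l \<ge> 2" and i: "i \<in> index" and j: "j \<in> index"
    and "\<bar>int (fst i) - int (fst j)\<bar> \<le> 2"
  shows "\<exists>n\<le>14. (i, j) \<in> adjacent ^^ n"
proof -
  have walk: "\<exists>n\<le>14. ((r, C), (r', D)) \<in> adjacent ^^ n"
    if prems: "C \<in> G" "D \<in> G" "1 \<le> r" "r \<le> r'" "r' \<le> Suc q" "r' \<le> r + 2" for r r' C D
  proof -
    consider "r' = r" | "r' = Suc r" | "r' = Suc (Suc r)" using prems by linarith
    then show ?thesis
    proof cases
      case 1
      then show ?thesis using walk_in_link[OF k l _ prems(1,2), of r] prems by (intro exI[of _ 3]) simp
    next
      case 2
      then show ?thesis using walk_next_link[OF k l _ prems(1,2), of r] prems by (intro exI[of _ 7]) simp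
    next
      case 3
      then have "((r, C), (Suc r, C)) \<in> adjacent ^^ 7" "((Suc r, C), (r', D)) \<in> adjacent ^^ 7"
        using walk_next_link[OF k l _ prems(1,1), of r] walk_next_link[OF k l _ prems(1,2), of "Suc r"] prems
        by simp_all
      then have "((r, C), (r', D)) \<in> adjacent ^^ (7 + 7)" unfolding relpow_add by blast
      then show ?thesis by (intro exI[of _ 14]) simp
    qed
  qed
  obtain r C where i': "i = (r, C)" by fastforce
  obtain r' D where j': "j = (r', D)" by fastforce
  show ?thesis
  proof (cases "r \<le> r'")
    case True
    then show ?thesis using walk[of C D r r'] assms i' j' by auto
  next
    case False
    then have "\<exists>n\<le>14. (j, i) \<in> adjacent ^^ n" using walk[of D C r' r] assms i' j' by auto
    then show ?thesis using adjacent_relpow_commute by blast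
  qed
qed

lemma connected:
  assumes k: "k \<ge> 5" and l: "l \<ge> 2" and i: "i \<in> index" and j: "j \<in> index"
  shows "\<exists>n. (i, j) \<in> adjacent ^^ n"
proof -
  have walk: "\<exists>n. ((r, C), (r + d, D)) \<in> adjacent ^^ n"
    if "C \<in> G" "D \<in> G" "1 \<le> r" "r + d \<le> Suc q" for r d C D
    using that(2,4)
  proof (induction d arbitrary: D)
    case 0
    then show ?case using walk_in_link[OF k l _ that(1), of r D] that by (intro exI[of _ 3]) simp
  next
    case (Suc d)
    then obtain n where "((r, C), (r + d, D)) \<in> adjacent ^^ n" by fastforce
    moreover have "((r + d, D), (r + Suc d, D)) \<in> adjacent ^^ 7"
      using walk_next_link[OF k l _ Suc.prems(1,1), of "r + d"] Suc.prems(2) that by simp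
    ultimately have "((r, C), (r + Suc d, D)) \<in> adjacent ^^ (n + 7)" unfolding relpow_add by blast
    then show ?case by blast
  qed
  obtain r C where i': "i = (r, C)" by fastforce
  obtain r' D where j': "j = (r', D)" by fastforce
  show ?thesis
  proof (cases "r \<le> r'")
    case True
    then show ?thesis using walk[of C D r "r' - r"] i j i' j' by auto
  next
    case False
    then have "\<exists>n. (j, i) \<in> adjacent ^^ n" using walk[of D C r' "r - r'"] i j i' j' by auto
    then show ?thesis using adjacent_relpow_commute by blast
  qed
qed

end


section \<open>Levels of the clause lists\<close>

context entangled
begin

context
  fixes f :: "nat \<times> 'a \<Rightarrow> nat" and Cs :: "nat list list"
  assumes inj_f: "inj_on f (\<Union>(clause_at ` index))"
    and distinct_Cs: "distinct (map set Cs)"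
    and set_Cs: "set ` set Cs = (\<lambda>i. f ` clause_at i) ` index"
begin

definition clause_graph :: "(nat list \<times> nat list) set" where
  "clause_graph = {(c, d). c \<in> set Cs \<and> d \<in> set Cs \<and> set c \<inter> set d \<noteq> {}}"

text \<open>An index is chosen because the family of clauses is not known to be injective.\<close>

definition origin :: "nat list \<Rightarrow> nat \<times> 'a clause" where
  "origin c = (SOME i. i \<in> index \<and> set c = f ` clause_at i)"

lemma origin:
  assumes "c \<in> set Cs"
  shows "origin c \<in> index" "set c = f ` clause_at (origin c)"
proof -
  have "set c \<in> (\<lambda>i. f ` clause_at i) ` index" using assms unfolding set_Cs[symmetric] by (rule imageI)
  then have "\<exists>i. i \<in> index \<and> set c = f ` clause_at i" by (auto simp only:)
  then have "origin c \<in> index \<and> set c = f ` clause_at (origin c)" unfolding origin_def by (rule someI_ex)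
  then show "origin c \<in> index" "set c = f ` clause_at (origin c)" by auto
qed

lemma inj_set: "inj_on set (set Cs)"
  using distinct_Cs by (simp add: distinct_map)

lemma meet_iff:
  assumes "i \<in> index" "j \<in> index"
  shows "f ` clause_at i \<inter> f ` clause_at j \<noteq> {} \<longleftrightarrow> (i, j) \<in> adjacent"
proof -
  have "f ` (clause_at i \<inter> clause_at j) = f ` clause_at i \<inter> f ` clause_at j"
    using assms by (intro inj_on_image_Int[OF inj_f]) blast+
  then show ?thesis using assms unfolding adjacent_def by auto
qed

lemma clause_graph_walk:
  assumes "(i, j) \<in> adjacent ^^ n" "c \<in> set Cs" "set c = f ` clause_at i"
    "d \<in> set Cs" "set d = f ` clause_at j"
  shows "(c, d) \<in> clause_graph ^^ n"
  using assms(1,4,5)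
proof (induction n arbitrary: j d)
  case 0
  then have "set c = set d" using assms(3) by simp
  then have "c = d" using inj_onD[OF inj_set] assms(2) 0(2) by blast
  then show ?case by simp
next
  case (Suc n)
  then obtain j' where j': "(i, j') \<in> adjacent ^^ n" "(j', j) \<in> adjacent" by auto
  have jj': "j' \<in> index" "j \<in> index" using adjacent_index[OF j'(2)] by simp_all
  then have "f ` clause_at j' \<in> set ` set Cs" unfolding set_Cs by (intro imageI)
  then obtain d' where d': "d' \<in> set Cs" "set d' = f ` clause_at j'" by (auto simp only:)
  then have "(d', d) \<in> clause_graph"
    using meet_iff[OF jj'] j'(2) Suc.prems by (simp add: clause_graph_def)
  then show ?case using Suc.IH[OF j'(1) d'] by auto
qed

text \<open>The factor is \<open>66 = 2 * (2 * 14 + 5)\<close>: two sides of \<open>a\<close>, walks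
  of length at most 14, and at most \<open>card G\<close> clauses per link.\<close>

lemma
  assumes k: "k \<ge> 5" and l: "l \<ge> 2" and a: "a \<in> set Cs"
  shows card_levels: "card {c \<in> set Cs. level clause_graph a c = j \<or> level clause_graph a c = j + 1} \<le> 66 * card G"
    and clause_graph_reach: "\<And>c. c \<in> set Cs \<Longrightarrow> (a, c) \<in> clause_graph\<^sup>*"
proof -
  define link where "link c = int (fst (origin c))" for c
  have reach: "(a, c) \<in> clause_graph\<^sup>*" if c: "c \<in> set Cs" for c
    using connected[OF k l origin(1)[OF a] origin(1)[OF c]] clause_graph_walk origin a c
    by (metis relpow_imp_rtrancl)
  then show "\<And>c. c \<in> set Cs \<Longrightarrow> (a, c) \<in> clause_graph\<^sup>*" .
  have mem: "c \<in> set Cs" if "(a, c) \<in> clause_graph\<^sup>*" for c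
    using that a by (induction rule: rtrancl_induct) (auto simp: clause_graph_def)
  have "card {c \<in> set Cs. level clause_graph a c = j \<or> level clause_graph a c = j + 1}
      \<le> 2 * ((2 * 14 + 5) * card G)"
  proof (rule card_two_levels[where link = link])
    fix c d assume "(c, d) \<in> clause_graph"
    then have cd: "c \<in> set Cs" "d \<in> set Cs" "set c \<inter> set d \<noteq> {}" by (auto simp: clause_graph_def)
    then have "(origin c, origin d) \<in> adjacent"
      using meet_iff[of "origin c" "origin d"] origin[of c] origin[of d] by simp
    then show "\<bar>link c - link d\<bar> \<le> 2" unfolding link_def by (rule adjacent_fst)
  next
    fix c d assume cd: "(a, c) \<in> clause_graph\<^sup>*" "(a, d) \<in> clause_graph\<^sup>*" "\<bar>link c - link d\<bar> \<le> 2"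
    then obtain n where "n \<le> 14" "(origin c, origin d) \<in> adjacent ^^ n"
      using short_walk[OF k l origin(1)[OF mem] origin(1)[OF mem], of c d] unfolding link_def by blast
    then show "\<exists>n\<le>14. (c, d) \<in> clause_graph ^^ n"
      using clause_graph_walk origin(2) mem cd by metis
  next
    show "card {c \<in> set Cs. link c = r} \<le> card G" for r
    proof -
      have "set ` {c \<in> set Cs. link c = r} \<subseteq> (\<lambda>C. f ` clause_at (nat r, C)) ` G"
      proof
        fix y assume "y \<in> set ` {c \<in> set Cs. link c = r}"
        then obtain c where c: "c \<in> set Cs" "link c = r" "y = set c" by blast
        obtain C where "origin c = (nat r, C)" using c(2) by (cases "origin c") (auto simp: link_def)
        then show "y \<in> (\<lambda>C. f ` clause_at (nat r, C)) ` G" using origin[OF c(1)] c(3) by auto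
      qed
      then have "card (set ` {c \<in> set Cs. link c = r}) \<le> card G"
        using finite_G by (meson card_image_le card_mono finite_imageI le_trans)
      moreover have "inj_on set {c \<in> set Cs. link c = r}" using inj_set by (rule inj_on_subset) auto
      ultimately show ?thesis by (simp add: card_image)
    qed
  qed (use reach in auto)
  then show "card {c \<in> set Cs. level clause_graph a c = j \<or> level clause_graph a c = j + 1} \<le> 66 * card G"
    by simp
qed

lemma length_Cs_le: "length Cs \<le> Suc q * card G"
proof -
  have "length Cs = card (set ` set Cs)" using distinct_card[OF distinct_Cs] by simp
  also have "\<dots> \<le> card index" unfolding set_Cs using finite_G by (intro card_image_le) simp
  finally show ?thesis by (simp add: card_cartesian_product)
qed

text \<open>For \<open>k < 5\<close> there are only \<open>O(1)\<close> clauses, and all of them are put on one level.\<close>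

lemma ex_levels:
  assumes l: "l \<ge> 2" and q: "Suc q \<le> l * card (vars G)" and Cs: "Cs = c # R"
  obtains lev where "sorted (map lev (layered [c] R))"
    "\<And>c d. c \<in> set Cs \<Longrightarrow> d \<in> set Cs \<Longrightarrow> set c \<inter> set d \<noteq> {} \<Longrightarrow> lev d \<le> lev c + (1::nat)"
    "\<And>j. card {d \<in> set Cs. lev d = j \<or> lev d = j + 1} \<le> 70 * l * card G"
proof (cases "k \<ge> 5")
  case k: True
  have c: "c \<in> set Cs" using Cs by simp
  note reach = clause_graph_reach[OF k l c]
  let ?lev = "level clause_graph c"
  have adj: "?lev d \<le> ?lev e + 1" if "e \<in> set Cs" "d \<in> set Cs" "set e \<inter> set d \<noteq> {}" for d e
    using that reach by (intro level_edge) (auto simp: clause_graph_def)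
  show ?thesis
  proof (rule that)
    have "c \<notin> set R" using distinct_Cs Cs by auto
    have lev_0: "?lev d = 0 \<longleftrightarrow> d = c" if "d \<in> set Cs" for d
      using level_eq_0[OF reach[OF that]] .
    have lev_pos: "0 < ?lev d \<longleftrightarrow> d \<noteq> c" if "d \<in> set Cs" for d
      unfolding lev_0[OF that, symmetric] by (rule neq0_conv[symmetric])
    have "{d \<in> set Cs. ?lev d = 0} = {d \<in> set Cs. d = c}"
      by (intro Collect_cong conj_cong refl) (rule lev_0)
    moreover have "{d \<in> set Cs. 0 < ?lev d} = {d \<in> set Cs. d \<noteq> c}"
      by (intro Collect_cong conj_cong refl) (rule lev_pos)
    ultimately have R: "set [c] = {d \<in> set Cs. ?lev d = 0}" "set R = {d \<in> set Cs. 0 < ?lev d}"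
      using \<open>c \<notin> set R\<close> Cs by auto
    show "sorted (map ?lev (layered [c] R))"
    proof (rule sorted_layered[OF adj])
      fix d i assume d: "d \<in> set Cs" "?lev d = Suc i"
      then obtain e where "(e, d) \<in> clause_graph" "?lev e = i" using level_pred[OF reach] by metis
      then show "\<exists>e\<in>set Cs. ?lev e = i \<and> set e \<inter> set d \<noteq> {}" unfolding clause_graph_def by blast
    qed (use R in auto)
  next
    show "card {d \<in> set Cs. ?lev d = j \<or> ?lev d = j + 1} \<le> 70 * l * card G" for j
    proof -
      \<comment> \<open>The constant \<open>70 * l\<close> is chosen to cover this case as well as
        \<open>k < 5\<close>, where \<open>16 * l\<close> arises.\<close>
      have "66 * card G \<le> 70 * l * card G" using l by (intro mult_le_mono1) simp
      then show ?thesis using card_levels[where j = j, OF k l c] by linarith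
    qed
  qed (use adj in auto)
next
  case False
  show ?thesis
  proof (rule that[of "\<lambda>_. 0"])
    show "sorted (map (\<lambda>_. 0) (layered [c] R))" by (simp add: map_replicate_const)
  next
    fix j
    have "card {d \<in> set Cs. 0 = j \<or> 0 = j + 1} \<le> card (set Cs)" by (intro card_mono) auto
    also have "\<dots> \<le> length Cs" by (rule card_length)
    also have "\<dots> \<le> Suc q * card G" by (rule length_Cs_le)
    \<comment> \<open>Counting incidences turns the bound \<open>l * n\<close> on the number of
      links into \<open>k * card G\<close>, and \<open>card G \<le> k * l\<close> is bounded for
      \<open>k \<le> 4\<close>.\<close>
    also have "\<dots> \<le> (k * card G) * card G" unfolding double_count using q by (rule mult_le_mono1)
    also have "\<dots> \<le> (4 * (4 * l)) * card G"
    proof (rule mult_le_mono1)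
      have "k * l \<le> 4 * l" using False by (intro mult_le_mono1) simp
      then have "card G \<le> 4 * l" using card_G_le by linarith
      then show "k * card G \<le> 4 * (4 * l)" using False by (intro mult_le_mono) auto
    qed
    also have "\<dots> \<le> 70 * l * card G" by simp
    finally show "card {d \<in> set Cs. 0 = j \<or> 0 = j + 1} \<le> 70 * l * card G" .
  qed auto
qed

end

text \<open>With a single variable \<open>ln n\<close> would vanish and the claimed bound would be
  constant. Two distinct clauses through one variable rule this out.\<close>

lemma card_vars_ge_2:
  assumes "l \<ge> 2"
  shows "card (vars G) \<ge> 2"
proof (rule ccontr)
  assume "\<not> card (vars G) \<ge> 2"
  obtain C t where C: "C \<in> G" "t \<in> C" using G_nonempty clause(2) by blast
  then obtain D where D: "D \<in> G" "t \<in> D" "D \<noteq> C" using other_clause[OF assms] by blast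
  have t: "t \<in> vars G" using in_vars C by blast
  then have "card (vars G) = 1"
    using \<open>\<not> card (vars G) \<ge> 2\<close> finite_vars by (metis One_nat_def Suc_1 Suc_leI card_gt_0_iff empty_iff le_antisym not_less_eq_eq)
  then have "vars G = {t}" using t by (metis card_1_singletonE singletonD)
  then have "C = {t}" "D = {t}" using C D by (auto simp: vars_def)
  then show False using D(3) by simp
qed

end


section \<open>Renaming variables, and 1-regular generators\<close>

lemma xsat_image:
  assumes "inj_on \<nu> (vars F)"
  shows "xsat ((`) \<nu> ` F) \<longleftrightarrow> xsat F"
proof
  assume "xsat ((`) \<nu> ` F)"
  then obtain \<tau> where "\<forall>D\<in>(`) \<nu> ` F. \<exists>!x. x \<in> D \<and> \<tau> x" unfolding xsat_def by (rule exE)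
  then have \<tau>: "\<exists>!x. x \<in> \<nu> ` C \<and> \<tau> x" if "C \<in> F" for C using that by (simp only: ball_simps)
  have "\<exists>!x. x \<in> C \<and> \<tau> (\<nu> x)" if C: "C \<in> F" for C
  proof -
    have "inj_on \<nu> C" using assms by (rule inj_on_subset) (use C in \<open>auto simp: vars_def\<close>)
    then show ?thesis using \<tau>[OF C] by (metis (no_types, lifting) imageE imageI inj_onD)
  qed
  then show "xsat F" unfolding xsat_def by (intro exI[of _ "\<lambda>x. \<tau> (\<nu> x)"]) blast
next
  assume "xsat F"
  then obtain \<tau> where "\<forall>C\<in>F. \<exists>!x. x \<in> C \<and> \<tau> x" unfolding xsat_def by (rule exE)
  then have \<tau>: "\<exists>!x. x \<in> C \<and> \<tau> x" if "C \<in> F" for C using that by (rule bspec)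
  define \<sigma> where "\<sigma> y \<longleftrightarrow> (\<exists>x\<in>vars F. \<nu> x = y \<and> \<tau> x)" for y
  have \<sigma>: "\<sigma> (\<nu> x) \<longleftrightarrow> \<tau> x" if "x \<in> vars F" for x
    using that assms by (auto simp: \<sigma>_def dest: inj_onD)
  have "\<exists>!y. y \<in> \<nu> ` C \<and> \<sigma> y" if C: "C \<in> F" for C
  proof -
    have "x \<in> vars F" if "x \<in> C" for x using that C by (auto simp: vars_def)
    then show ?thesis using \<tau>[OF C] \<sigma> by (metis (no_types, lifting) imageE imageI)
  qed
  then show "xsat ((`) \<nu> ` F)" unfolding xsat_def by (intro exI[of _ \<sigma>]) blast
qed

lemma xsat_disjoint:
  assumes "\<And>C. C \<in> F \<Longrightarrow> C \<noteq> {}" "\<And>C D. C \<in> F \<Longrightarrow> D \<in> F \<Longrightarrow> C \<noteq> D \<Longrightarrow> C \<inter> D = {}"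
  shows "xsat F"
proof -
  define g where "g C = (SOME x. x \<in> C)" for C :: "'a set"
  have g: "g C \<in> C" if "C \<in> F" for C using assms(1)[OF that] unfolding g_def by (simp add: some_in_eq)
  have "\<exists>!x. x \<in> C \<and> x \<in> g ` F" if C: "C \<in> F" for C
  proof (rule ex1I[of _ "g C"])
    show "g C \<in> C \<and> g C \<in> g ` F" using g C by blast
  next
    fix x assume x: "x \<in> C \<and> x \<in> g ` F"
    then obtain D where D: "D \<in> F" "x = g D" by blast
    then have "C \<inter> D \<noteq> {}" using g x by blast
    then show "x = g C" using assms(2) C D by blast
  qed
  then show ?thesis unfolding xsat_def by (intro exI[of _ "\<lambda>x. x \<in> g ` F"]) blast
qed

text \<open>Two clauses of \<open>G\<close> share a variable that lies in only one clause, so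
  \<open>G\<close> is a single clause. Its copies remain pairwise disjoint after entangling.\<close>

lemma (in entangled) xsat_if_1_regular:
  assumes "l = 1" "inj_on f (\<Union>(clause_at ` index))"
  shows "xsat ((\<lambda>i. f ` clause_at i) ` index)"
proof (rule xsat_disjoint)
  fix A assume "A \<in> (\<lambda>i. f ` clause_at i) ` index"
  then show "A \<noteq> {}" using clause_at_nonempty by blast
next
  fix A B assume "A \<in> (\<lambda>i. f ` clause_at i) ` index" "B \<in> (\<lambda>i. f ` clause_at i) ` index" "A \<noteq> B"
  then obtain r C r' C' where A: "A = f ` clause_at (r, C)" "(r, C) \<in> index"
    and B: "B = f ` clause_at (r', C')" "(r', C') \<in> index" by fast
  have "C = C'"
  proof -
    obtain t where t: "t \<in> C" "t \<in> C'" using intersect[of C C'] A(2) B(2) by blast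
    then have "card {D \<in> G. t \<in> D} = 1"
      using card_clauses_containing[of t] in_vars[of C t] A(2) assms(1) by simp
    then obtain E where E: "{D \<in> G. t \<in> D} = {E}" by (rule card_1_singletonE)
    have "C \<in> {D \<in> G. t \<in> D}" "C' \<in> {D \<in> G. t \<in> D}" using t A(2) B(2) by auto
    then show ?thesis unfolding E by simp
  qed
  then have "clause_at (r, C) \<inter> clause_at (r', C') = {}"
    using disjoint_copies \<open>A \<noteq> B\<close> A(1) B(1) by blast
  moreover have "f ` (clause_at (r, C) \<inter> clause_at (r', C')) = A \<inter> B"
    unfolding A(1) B(1) using A(2) B(2) by (intro inj_on_image_Int[OF assms(2)]) blast+
  ultimately show "A \<inter> B = {}" by simp
qed


section \<open>The time bound\<close>

lemma size_encode_cnf_le: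
  assumes "\<And>c. c \<in> set Cs \<Longrightarrow> distinct c \<and> set c \<subseteq> {..<M}" and "M \<ge> 1"
  shows "size (encode_cnf Cs) \<le> length Cs * (4 * M ^ 2)"
proof -
  have "size (encode_clause c) + 1 \<le> 4 * M ^ 2" if c: "c \<in> set Cs" for c
  proof -
    have "size (encode_nat v) + 1 \<le> 2 * M" if "v \<in> set c" for v
    proof -
      have "v < M" using assms(1)[OF c] that by blast
      then show ?thesis using size_encode_nat_le[of v] by linarith
    qed
    then have "size (encode_clause c) \<le> (\<Sum>v\<leftarrow>c. 2 * M)"
      unfolding size_encode_list by (intro sum_list_mono) simp
    also have "\<dots> = length c * (2 * M)" by (simp add: sum_list_triv)
    also have "length c = card (set c)" using assms(1)[OF c] by (simp add: distinct_card)
    also have "card (set c) * (2 * M) \<le> M * (2 * M)"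
      using assms(1)[OF c] card_mono[of "{..<M}" "set c"] by (intro mult_le_mono1) simp
    finally have "size (encode_clause c) \<le> 2 * M ^ 2" by (simp add: power2_eq_square)
    moreover have "M ^ 2 \<ge> 1" using assms(2) by simp
    ultimately show ?thesis by linarith
  qed
  then have "size (encode_cnf Cs) \<le> (\<Sum>c\<leftarrow>Cs. 4 * M ^ 2)"
    unfolding size_encode_list[of encode_clause] by (intro sum_list_mono)
  then show ?thesis by (simp add: sum_list_triv)
qed

text \<open>With \<open>X + 1 \<le> Y = 5 * l ^ 4 * n ^ 6\<close> the running time is at most
  \<open>4800 * Y ^ 9 * 2 ^ (2 * B)\<close>, and \<open>Y ^ 9\<close> yields \<open>n ^ 54\<close>.
  Replacing 2 by \<open>exp 1\<close> gives the exponent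
  \<open>2 * B \<le> 140 * l ^ 2 * sqrt n\<close>; the factor \<open>2 * ln n \<ge> 1\<close> makes
  it 280.\<close>

lemma time_bound:
  fixes X B l m n :: nat
  assumes n: "n \<ge> 2" and l: "l \<ge> 1" and X: "X \<le> 4 * l ^ 4 * n ^ 6"
    and B: "B = 70 * l * m" and m: "m ^ 2 \<le> l ^ 2 * n"
  shows "real (1200 * ((X + 1) ^ 7 * (X * 2 ^ B + 2) ^ 2))
    \<le> (4800 * (5 * real l ^ 4) ^ 9) * exp ((54 + 280 * real l ^ 2) * ln (real n) * sqrt (real n))"
proof -
  define Y where "Y = 5 * l ^ 4 * n ^ 6"
  have "l ^ 4 * n ^ 6 \<ge> 1" using n l by (simp add: Suc_le_eq)
  then have XY: "X + 1 \<le> Y" using X unfolding Y_def by linarith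
  have "X * 2 ^ B + 2 \<le> 2 * (X + 1) * 2 ^ B"
    using one_le_power[of "2::nat" B] by (simp add: algebra_simps trans_le_add2)
  also have "\<dots> \<le> 2 * Y * 2 ^ B" using XY by (intro mult_le_mono) auto
  finally have XB: "X * 2 ^ B + 2 \<le> 2 * Y * 2 ^ B" .
  have "1200 * ((X + 1) ^ 7 * (X * 2 ^ B + 2) ^ 2) \<le> 1200 * (Y ^ 7 * (2 * Y * 2 ^ B) ^ 2)"
    using XY XB by (intro mult_le_mono power_mono) auto
  also have "\<dots> = 4800 * (Y ^ 9 * (2 ^ B) ^ 2)"
    by (simp add: power_mult_distrib flip: power_add mult.assoc)
  finally have "real (1200 * ((X + 1) ^ 7 * (X * 2 ^ B + 2) ^ 2)) \<le> real (4800 * (Y ^ 9 * (2 ^ B) ^ 2))"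
    using of_nat_mono by blast
  also have "\<dots> = 4800 * (real Y ^ 9 * (2 ^ B) ^ 2)" by simp
  also have "real Y ^ 9 = (5 * real l ^ 4) ^ 9 * real n ^ 54"
    by (simp add: Y_def power_mult_distrib flip: power_mult)
  also have "real n ^ 54 = exp (54 * ln (real n))"
    using n by (simp add: exp_of_nat_mult[of 54, simplified])
  also have "4800 * ((5 * real l ^ 4) ^ 9 * exp (54 * ln (real n)) * (2 ^ B) ^ 2)
      \<le> 4800 * ((5 * real l ^ 4) ^ 9 * exp (54 * ln (real n)) * exp (real B) ^ 2)"
  proof -
    have "(2::real) ^ B \<le> exp 1 ^ B" using exp_ge_add_one_self[of 1] by (intro power_mono) auto
    then have "(2::real) ^ B \<le> exp (real B)" by (simp flip: exp_of_nat_mult)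
    then show ?thesis by (intro mult_left_mono power_mono) auto
  qed
  also have "\<dots> = (4800 * (5 * real l ^ 4) ^ 9) * exp (54 * ln (real n) + 2 * real B)"
    by (simp add: exp_add exp_double)
  also have "\<dots> \<le> (4800 * (5 * real l ^ 4) ^ 9) * exp ((54 + 280 * real l ^ 2) * ln (real n) * sqrt (real n))"
  proof (intro mult_left_mono)
    have ln_n: "ln (real n) \<ge> 1 / 2"
    proof -
      \<comment> \<open>From \<open>ln x \<le> x - 1\<close> at \<open>x = 1 / 2\<close>.\<close>
      have "1 / 2 \<le> ln (2::real)" using ln_le_minus_one[of "1 / 2 :: real"] by (simp add: ln_div)
      also have "\<dots> \<le> ln (real n)" using n by simp
      finally show ?thesis .
    qed
    have sqrt_n: "sqrt (real n) \<ge> 1" using n by simp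
    have "real m ^ 2 \<le> real l ^ 2 * real n" using m by (metis of_nat_le_iff of_nat_mult of_nat_power)
    then have "real m \<le> real l * sqrt (real n)"
      by (metis of_nat_0_le_iff real_le_rsqrt real_sqrt_abs2 real_sqrt_mult abs_of_nat power2_eq_square)
    then have "2 * real B \<le> 140 * real l * (real l * sqrt (real n))"
      unfolding B by (simp add: mult_left_mono)
    also have "\<dots> = 140 * real l ^ 2 * sqrt (real n)" by (simp add: power2_eq_square)
    also have "\<dots> \<le> 280 * real l ^ 2 * sqrt (real n) * ln (real n)"
    proof -
      have "140 * real l ^ 2 * sqrt (real n) * 1 \<le> 140 * real l ^ 2 * sqrt (real n) * (2 * ln (real n))"
        using ln_n by (intro mult_left_mono) auto
      then show ?thesis by simp
    qed
    finally have "2 * real B \<le> 280 * real l ^ 2 * sqrt (real n) * ln (real n)" .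
    moreover have "54 * ln (real n) \<le> 54 * ln (real n) * sqrt (real n)"
      using sqrt_n ln_n by (simp add: mult_le_cancel_left1)
    ultimately show "exp (54 * ln (real n) + 2 * real B)
      \<le> exp ((54 + 280 * real l ^ 2) * ln (real n) * sqrt (real n))"
      by (simp add: algebra_simps)
  qed simp
  finally show ?thesis .
qed


lemma vars_chain_le:
  assumes "entangled G l k q pos"
  shows "card (\<Union>(entangle_first q pos ` ({1..Suc q} \<times> G))) \<le> Suc q * card (vars G)"
proof -
  interpret entangled G l k q pos by fact
  have "card (\<Union>(clause_at ` index)) \<le> card ({1..Suc q} \<times> vars G)"
    using finite_vars by (intro card_mono Union_clause_at_subset) simp
  then show ?thesis by (simp add: card_cartesian_product)
qed

lemma prog_decides:
  fixes F :: "'v formula" and x :: tree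
  assumes "entangled G l k q pos" and l: "l \<ge> 2" and q: "Suc q \<le> l * card (vars G)"
    and \<rho>: "inj_on \<rho> ({1..Suc q} \<times> vars G)"
    and F: "F = (\<lambda>i. \<rho> ` entangle_first q pos i) ` ({1..Suc q} \<times> G)"
    and x: "encodes x F"
  shows "\<exists>t. computes_in prog x (encode_bool (xsat F)) t \<and>
    real t \<le> (4800 * (5 * real l ^ 4) ^ 9) *
      exp ((54 + 280 * real l ^ 2) * ln (real (card (vars G))) * sqrt (real (card (vars G))))"
proof -
  interpret entangled G l k q pos by fact
  obtain \<nu> Cs where \<nu>: "bij_betw \<nu> (vars F) {..<card (vars F)}"
    and distinct: "\<forall>C\<in>set Cs. distinct C" "distinct (map set Cs)"
    and set_Cs: "set (map set Cs) = (\<lambda>C. \<nu> ` C) ` F" and x_eq: "x = encode_cnf Cs"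
    using x unfolding encodes_def by blast
  let ?n = "card (vars G)"
  let ?used = "\<Union>(clause_at ` index)"
  note used = Union_clause_at_subset
  have vars_F: "vars F = \<rho> ` ?used" unfolding F vars_def by blast
  have inj: "inj_on (\<nu> \<circ> \<rho>) ?used"
    using inj_on_subset[OF \<rho> used] \<nu> vars_F by (intro comp_inj_on) (auto simp: bij_betw_def)
  have img: "set ` set Cs = (\<lambda>i. (\<nu> \<circ> \<rho>) ` clause_at i) ` index"
    using set_Cs unfolding F by (simp add: image_image image_comp)
  have "F \<noteq> {}" using G_nonempty unfolding F by auto
  then have "Cs \<noteq> []" using set_Cs by auto
  then obtain c R where Cs: "Cs = c # R" by (cases Cs) auto
  obtain lev where lev: "sorted (map lev (layered [c] R))"
    "\<And>c d. c \<in> set Cs \<Longrightarrow> d \<in> set Cs \<Longrightarrow> set c \<inter> set d \<noteq> {} \<Longrightarrow> lev d \<le> lev c + (1::nat)"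
    "\<And>j. card {d \<in> set Cs. lev d = j \<or> lev d = j + 1} \<le> 70 * l * card G"
    using ex_levels[OF inj distinct(2) img l q Cs] by blast
  define X where "X = size (encode_cnf (c # R))"
  define B where "B = 70 * l * card G"
  have "set (layered [c] R) = set Cs" using Cs by (simp add: set_layered)
  then have "run prog MAIN [encode_cnf (c # R)] (encode_bool (xsat (set ` set (c # R))))
      (1200 * ((X + 1) ^ 7 * (X * 2 ^ B + 2) ^ 2))"
    using lev unfolding X_def B_def by (intro run_main_levels) auto
  moreover have "xsat (set ` set Cs) = xsat F"
    using xsat_image[of \<nu> F] \<nu> set_Cs by (simp add: bij_betw_def)
  ultimately obtain t where t: "eval prog [x] (prog ! 0) (encode_bool (xsat F)) t"
    "t \<le> 1200 * ((X + 1) ^ 7 * (X * 2 ^ B + 2) ^ 2)"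
    unfolding run_def evb_def MAIN_def Cs[symmetric] x_eq by auto
  have n: "?n \<ge> 2" using card_vars_ge_2[OF l] .
  have "X \<le> 4 * l ^ 4 * ?n ^ 6"
  proof -
    define M where "M = Suc q * ?n"
    have "card (vars F) \<le> M"
    proof -
      have "card (vars F) \<le> card ?used"
        unfolding vars_F using used finite_vars by (intro card_image_le) (auto intro: finite_subset)
      then show ?thesis using vars_chain_le[OF assms(1)] unfolding M_def by linarith
    qed
    moreover have "set c \<subseteq> {..<card (vars F)}" if "c \<in> set Cs" for c
    proof -
      have "set c \<in> (\<lambda>C. \<nu> ` C) ` F" using that set_Cs by auto
      then have "set c \<subseteq> \<nu> ` vars F" unfolding vars_def by blast
      then show ?thesis using \<nu> by (simp add: bij_betw_def)
    qed
    ultimately have "size (encode_cnf Cs) \<le> length Cs * (4 * M ^ 2)"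
      using distinct(1) n by (intro size_encode_cnf_le) (fastforce simp: M_def)+
    \<comment> \<open>The chain has at most \<open>l * n\<close> links with
      \<open>card G \<le> k * card G = l * n\<close> clauses each, and at most
      \<open>l * n ^ 2\<close> variables.\<close>
    also have "\<dots> \<le> (l * ?n) ^ 2 * (4 * (l * ?n ^ 2) ^ 2)"
    proof (intro mult_le_mono power_mono order_refl)
      have "card G \<le> k * card G" using k_pos by simp
      then have "Suc q * card G \<le> (l * ?n) * (l * ?n)"
        using q double_count by (intro mult_le_mono) simp_all
      then show "length Cs \<le> (l * ?n) ^ 2"
        using length_Cs_le[OF inj distinct(2) img] by (simp add: power2_eq_square)
      have "Suc q * ?n \<le> l * ?n * ?n" using q by (rule mult_le_mono1)
      then show "M \<le> l * ?n ^ 2" by (simp add: M_def power2_eq_square mult.assoc)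
    qed simp
    also have "\<dots> = 4 * l ^ 4 * ?n ^ 6"
      by algebra
    finally show ?thesis unfolding X_def Cs .
  qed
  moreover have "card G ^ 2 \<le> l ^ 2 * ?n"
  proof -
    have "card G * card G \<le> (k * l) * card G" using card_G_le by (rule mult_le_mono1)
    also have "\<dots> = l * (k * card G)" by simp
    also have "\<dots> = l * (l * ?n)" by (simp only: double_count)
    finally show ?thesis by (simp add: power2_eq_square)
  qed
  ultimately have "real (1200 * ((X + 1) ^ 7 * (X * 2 ^ B + 2) ^ 2))
    \<le> (4800 * (5 * real l ^ 4) ^ 9) * exp ((54 + 280 * real l ^ 2) * ln (real ?n) * sqrt (real ?n))"
    using l by (intro time_bound[OF n _ _ B_def]) auto
  moreover have "real t \<le> real (1200 * ((X + 1) ^ 7 * (X * 2 ^ B + 2) ^ 2))"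
    using t(2) of_nat_mono by blast
  ultimately have "real t \<le> (4800 * (5 * real l ^ 4) ^ 9) *
      exp ((54 + 280 * real l ^ 2) * ln (real ?n) * sqrt (real ?n))"
    by (rule order_trans[rotated])
  moreover have "computes_in prog x (encode_bool (xsat F)) t"
    using t(1) by (simp add: computes_in_def prog_def)
  ultimately show ?thesis by blast
qed

theorem theorem7:
  fixes l :: nat
  assumes "l \<ge> 1"
  shows "\<exists>(\<alpha>::real) (A::program) (c::real).
    \<forall>(k::nat) (G::nat formula) (n::nat) (p::nat) (F::nat formula) (x::tree).
      k \<ge> 1 \<and> monotone_cnf G \<and> exact_linear G \<and> regular l G \<and> uniform k G \<and>
      n = card (vars G) \<and> p \<in> {2..l * n} \<and> entangled_chain p G F \<and> encodes x F \<longrightarrow>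
      (\<exists>t. computes_in A x (encode_bool (xsat F)) t \<and>
           real t \<le> c * exp (\<alpha> * ln (real n) * sqrt (real n)))"
proof -
  have chain: thesis
    if asm: "monotone_cnf G" "exact_linear G" "regular l G" "uniform k G" "p \<ge> 2" "entangled_chain p G F"
      and thesis: "\<And>q pos \<rho>. p = Suc q \<Longrightarrow> entangled G l k q pos \<Longrightarrow> inj_on \<rho> ({1..Suc q} \<times> vars G) \<Longrightarrow>
        F = (\<lambda>i. \<rho> ` entangle_first q pos i) ` ({1..Suc q} \<times> G) \<Longrightarrow> thesis"
    for G :: "nat formula" and F :: "nat formula" and k p thesis
  proof -
    have p: "p = Suc (p - 1)" using asm(5) by simp
    obtain pos \<rho> where c: "\<forall>r\<in>{1..p-1}. fst (pos r) \<in> G \<and> snd (pos r) \<in> fst (pos r)"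
      "inj_on pos {1..p-1}" "inj_on \<rho> ({1..p} \<times> vars G)"
      "F = (\<lambda>i. \<rho> ` entangle_first (p - 1) pos i) ` ({1..p} \<times> G)"
      using asm(6) unfolding entangled_chain_def by blast
    have "entangled G l k (p - 1) pos"
      using asm(1-4) c(1,2) by unfold_locales auto
    then show thesis using thesis[OF p] c(3,4) p by simp
  qed
  show ?thesis
  \<comment> \<open>The program may depend on \<open>l\<close>: a constant answer in three steps for
    \<open>l = 1\<close>, the search otherwise.\<close>
  proof (cases "l = 1")
    case True
    have "computes_in [ETrue] x (encode_bool (xsat F)) 3 \<and>
        real 3 \<le> 3 * exp (0 * ln (real n) * sqrt (real n))"
      if asm: "monotone_cnf G" "exact_linear G" "regular l G" "uniform k G" "p \<ge> 2" "entangled_chain p G F"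
      for G :: "nat formula" and F :: "nat formula" and k p n x
    proof (rule chain[OF asm])
      fix q pos \<rho> assume c: "entangled G l k q pos" "inj_on \<rho> ({1..Suc q} \<times> vars G)"
        "F = (\<lambda>i. \<rho> ` entangle_first q pos i) ` ({1..Suc q} \<times> G)"
      interpret entangled G l k q pos by fact
      have "inj_on \<rho> (\<Union>(clause_at ` index))"
        using c(2) Union_clause_at_subset by (rule inj_on_subset)
      then have "xsat F" unfolding c(3) by (rule xsat_if_1_regular[OF True])
      moreover have "eval [ETrue] [x] ETrue (Cell Atom Atom) (1 + 1 + 1)"
        by (intro eval_Cons eval_Atom)
      ultimately show ?thesis by (simp add: computes_in_def numeral_3_eq_3)
    qed
    then show ?thesis by (intro exI[of _ 0] exI[of _ "[ETrue]"] exI[of _ 3]) fastforce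
  next
    case False
    then have l: "l \<ge> 2" using assms by simp
    have "\<exists>t. computes_in prog x (encode_bool (xsat F)) t \<and>
        real t \<le> (4800 * (5 * real l ^ 4) ^ 9) *
          exp ((54 + 280 * real l ^ 2) * ln (real (card (vars G))) * sqrt (real (card (vars G))))"
      if asm: "monotone_cnf G" "exact_linear G" "regular l G" "uniform k G"
        "p \<in> {2..l * card (vars G)}" "entangled_chain p G F" "encodes x F"
      for G :: "nat formula" and F :: "nat formula" and k p x
    proof (rule chain[OF asm(1-4) _ asm(6)])
      fix q pos \<rho> assume c: "p = Suc q" "entangled G l k q pos" "inj_on \<rho> ({1..Suc q} \<times> vars G)"
        "F = (\<lambda>i. \<rho> ` entangle_first q pos i) ` ({1..Suc q} \<times> G)"
      show ?thesis using asm(5) c(1) by (intro prog_decides[OF c(2) l _ c(3,4) asm(7)]) simp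
    next
      show "2 \<le> p" using asm(5) by simp
    qed
    then show ?thesis by blast
  qed
qed

end
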